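(* Let $k$ be a field of characteristic zero and let $P\in M_2(k)$ be a moduli point corresponding to a $\bar k$-conjugacy class of quadratic rational maps with trivial automorphism group. Let $s_1,s_2,s_3,r\in k$ be weighted projective coordinates with values in $k$ corresponding to $P$, and let $b_i$, $a_{ijk}$ ($i,j,k\in\mathbb{F}_2$) be the corresponding values of the invariants so denoted. Let $W_0,W_1\in k[X_0,X_1]$ be any pair of linear forms for which the corresponding coordinate transformation $$X_0\mapsto W_0(X_0,X_1),\qquad X_1\mapsto W_1(X_0,X_1)$$ is in $\mathrm{SL}_2(k)$. Then the linear and cubic forms $$f=b_0W_0-b_1W_1,\qquad g=\frac{9}{2r}\sum_{i,j,k\in\mathbb{F}_2}(-1)^{i+j+k}\,a_{ijk}\,W_{i+1}W_{j+1}W_{k+1}$$ (indices of $W$ taken modulo $2$) have coefficients in $k$ and correspond to the moduli point $P$, i.e. $[f,g]=P$.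
   Context: $k$ is a field of characteristic zero with algebraic closure $\bar k$. Transvectants: for binary forms $F,G$ in $X_0,X_1$ of orders $m,n$, $$(F,G)_q=\frac{(m-q)!(n-q)!}{m!\,n!}\sum_{l=0}^q(-1)^l\binom{q}{l}\frac{\partial^qF}{\partial X_0^{q-l}\partial X_1^{l}}\,\frac{\partial^qG}{\partial X_0^{l}\partial X_1^{q-l}} .$$ Quadratic maps as pairs of forms: a quadratic rational map $\phi=[F_0:F_1]$ ($F_0,F_1$ binary quadratic forms in $X_0,X_1$ without common factor) is specified by the pair $(f,g)$ with $f=\partial F_0/\partial X_0+\partial F_1/\partial X_1$ (linear form) and $g=X_1F_0-X_0F_1$ (cubic form); $(F_0,F_1)\mapsto(f,g)$ is a linear isomorphism. Covariants and invariants of $(f,g)$: $H=(g,g)_2$, $t=(g,H)_1$, $V_0=(H,f)_1$, $V_1=(g,f^2)_2$; the basic invariants are $$s_1=(g,f^3)_3,\quad s_2=(H,f^2)_2,\quad s_3=(t,g)_3,\quad r=(t,f^3)_3,$$ of degrees $4,4,4,6$ in the coefficients of $(f,g)$, satisfying $r^2-\frac12s_1^2s_3+\frac12s_2^3=0$. Further invariants are $b_0=(V_1,f)_1$ and $b_1=(V_0,f)_1$ (equal to $s_1$ and $s_2$ respectively), and the $a_{ijk}$, symmetric in their indices and given by $$a_{000}=\tfrac19s_3r,\quad a_{100}=0,\quad a_{110}=-\tfrac19s_2r,\quad a_{111}=-\tfrac29s_1r .$$ Moduli space: the coarse moduli space $M_2$ of quadratic rational maps up to conjugation by $\mathrm{PGL}_2(\bar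 k)$ is identified, via the invariants, with a subvariety of the weighted projective space $\mathbb{P}(4,4,4,6)$; the point corresponding to a pair $(f,g)$ is $[f,g]=[s_1:s_2:s_3:r]$, with the invariants evaluated at $(f,g)$. Every $P\in M_2(k)$ has weighted projective coordinates in $k$. The automorphism group of $\phi$ is $\{\gamma\in\mathrm{PGL}_2(\bar k):\gamma^{-1}\circ\phi\circ\gamma=\phi\}$; it is trivial exactly when $r\neq0$ at the corresponding point.
   Formalization: The prefactor of g is -9/(2r) instead of the printed 9/(2r); the printed sign fails, e.g. for the class of f=X_0, g=X_0^3+X_1^3 with W_0=X_0, W_1=X_1, where it gives [1:0:2:1] instead of [-1:0:2:1]. *)

theory Defs
  imports "HOL-Algebra.Algebraic_Closure_Type" "HOL-Library.Z2"
begin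

text \<open>
  The ring \<open>k[X\<^sub>0, X\<^sub>1]\<close> is rendered as \<^typ>\<open>'a poly poly\<close>: the inner variable is \<open>X\<^sub>0\<close>, the
  outer one is \<open>X\<^sub>1\<close>, so that the coefficient of \<open>X\<^sub>0\<^sup>i X\<^sub>1\<^sup>j\<close> in \<open>F\<close> is \<open>coeff (coeff F j) i\<close>.
\<close>

type_synonym 'a bpoly = "'a poly poly"

definition const :: "'a::comm_ring_1 \<Rightarrow> 'a bpoly" where
  "const c = [:[:c:]:]"

definition X\<^sub>0 :: "'a::comm_ring_1 bpoly" where
  "X\<^sub>0 = [:[:0, 1:]:]"

definition X\<^sub>1 :: "'a::comm_ring_1 bpoly" where
  "X\<^sub>1 = [:0, 1:]"

definition bcoeff :: "'a::comm_ring_1 bpoly \<Rightarrow> nat \<Rightarrow> nat \<Rightarrow> 'a" where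
  "bcoeff F i j = coeff (coeff F j) i"

text \<open>As usual, the zero polynomial is a form of every order.\<close>

definition binary_form :: "nat \<Rightarrow> 'a::comm_ring_1 bpoly \<Rightarrow> bool" where
  "binary_form n F \<longleftrightarrow> (\<forall>i j. bcoeff F i j \<noteq> 0 \<longrightarrow> i + j = n)"

definition pd\<^sub>0 :: "'a::idom bpoly \<Rightarrow> 'a bpoly" where
  "pd\<^sub>0 F = map_poly pderiv F"

definition pd\<^sub>1 :: "'a::idom bpoly \<Rightarrow> 'a bpoly" where
  "pd\<^sub>1 F = pderiv F"

text \<open>The substitution \<open>F(A\<^sub>0, A\<^sub>1)\<close>.\<close>

definition bsubst :: "'a::comm_ring_1 bpoly \<Rightarrow> 'a bpoly \<Rightarrow> 'a bpoly \<Rightarrow> 'a bpoly" where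
  "bsubst F A\<^sub>0 A\<^sub>1 = poly (map_poly (\<lambda>c. poly (map_poly const c) A\<^sub>0) F) A\<^sub>1"

text \<open>The form over the algebraic closure defined by a form over the base field.\<close>

definition bembed :: "'k::field bpoly \<Rightarrow> 'k alg_closure bpoly" where
  "bembed F = map_poly (map_poly to_ac) F"


subsection \<open>Transvectants\<close>

text \<open>
  The orders \<open>m\<close>, \<open>n\<close> of the two forms are explicit arguments, since they enter the normalising
  factor and cannot be recovered from a form that happens to be zero.
\<close>

definition transvectant ::
  "nat \<Rightarrow> nat \<Rightarrow> nat \<Rightarrow> 'a::field_char_0 bpoly \<Rightarrow> 'a bpoly \<Rightarrow> 'a bpoly" where
  "transvectant m n q F G =
     const (fact (m - q) * fact (n - q) / (fact m * fact n)) *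
     (\<Sum>l\<le>q. (- 1) ^ l * of_nat (q choose l) *
        (pd\<^sub>0 ^^ (q - l)) ((pd\<^sub>1 ^^ l) F) * (pd\<^sub>0 ^^ l) ((pd\<^sub>1 ^^ (q - l)) G))"


subsection \<open>Covariants and invariants of a pair of a linear form \<open>f\<close> and a cubic form \<open>g\<close>\<close>

definition cov_H :: "'a::field_char_0 bpoly \<Rightarrow> 'a bpoly" where
  "cov_H g = transvectant 3 3 2 g g"

definition cov_t :: "'a::field_char_0 bpoly \<Rightarrow> 'a bpoly" where
  "cov_t g = transvectant 3 2 1 g (cov_H g)"

definition cov_V\<^sub>0 :: "'a::field_char_0 bpoly \<Rightarrow> 'a bpoly \<Rightarrow> 'a bpoly" where
  "cov_V\<^sub>0 f g = transvectant 2 1 1 (cov_H g) f"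

definition cov_V\<^sub>1 :: "'a::field_char_0 bpoly \<Rightarrow> 'a bpoly \<Rightarrow> 'a bpoly" where
  "cov_V\<^sub>1 f g = transvectant 3 2 2 g (f ^ 2)"

text \<open>An invariant is a form of order 0; its value is read off as its constant coefficient.\<close>

definition inv_s\<^sub>1 :: "'a::field_char_0 bpoly \<Rightarrow> 'a bpoly \<Rightarrow> 'a" where
  "inv_s\<^sub>1 f g = bcoeff (transvectant 3 3 3 g (f ^ 3)) 0 0"

definition inv_s\<^sub>2 :: "'a::field_char_0 bpoly \<Rightarrow> 'a bpoly \<Rightarrow> 'a" where
  "inv_s\<^sub>2 f g = bcoeff (transvectant 2 2 2 (cov_H g) (f ^ 2)) 0 0"

definition inv_s\<^sub>3 :: "'a::field_char_0 bpoly \<Rightarrow> 'a bpoly \<Rightarrow> 'a" where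
  "inv_s\<^sub>3 f g = bcoeff (transvectant 3 3 3 (cov_t g) g) 0 0"

definition inv_r :: "'a::field_char_0 bpoly \<Rightarrow> 'a bpoly \<Rightarrow> 'a" where
  "inv_r f g = bcoeff (transvectant 3 3 3 (cov_t g) (f ^ 3)) 0 0"

definition inv_b :: "bit \<Rightarrow> 'a::field_char_0 bpoly \<Rightarrow> 'a bpoly \<Rightarrow> 'a" where
  "inv_b i f g =
     (if i = 0 then bcoeff (transvectant 1 1 1 (cov_V\<^sub>1 f g) f) 0 0
      else bcoeff (transvectant 1 1 1 (cov_V\<^sub>0 f g) f) 0 0)"

text \<open>\<open>a\<^sub>i\<^sub>j\<^sub>k\<close> is symmetric in its indices, hence depends only on the number of indices equal to 1.\<close>

definition inv_a :: "bit \<Rightarrow> bit \<Rightarrow> bit \<Rightarrow> 'a::field_char_0 bpoly \<Rightarrow> 'a bpoly \<Rightarrow> 'a" where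
  "inv_a i j k f g =
     (let n = of_bit i + of_bit j + of_bit k :: nat in
      if n = 0 then 1/9 * inv_s\<^sub>3 f g * inv_r f g
      else if n = 1 then 0
      else if n = 2 then - 1/9 * inv_s\<^sub>2 f g * inv_r f g
      else - 2/9 * inv_s\<^sub>1 f g * inv_r f g)"


subsection \<open>Quadratic rational maps and their automorphisms\<close>

definition quadratic_map :: "'a::field bpoly \<times> 'a bpoly \<Rightarrow> bool" where
  "quadratic_map \<phi> \<longleftrightarrow>
     binary_form 2 (fst \<phi>) \<and> binary_form 2 (snd \<phi>) \<and> coprime (fst \<phi>) (snd \<phi>)"

text \<open>The pair \<open>(f, g)\<close> specifying \<open>\<phi> = [F\<^sub>0 : F\<^sub>1]\<close>.\<close>

definition pair_of_map :: "'a::idom bpoly \<times> 'a bpoly \<Rightarrow> 'a bpoly \<times> 'a bpoly" where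
  "pair_of_map \<phi> = (pd\<^sub>0 (fst \<phi>) + pd\<^sub>1 (snd \<phi>), X\<^sub>1 * fst \<phi> - X\<^sub>0 * snd \<phi>)"

text \<open>
  \<open>rat_map (F\<^sub>0, F\<^sub>1)\<close> is the rational map \<open>[F\<^sub>0 : F\<^sub>1]\<close> for coprime forms \<open>F\<^sub>0\<close>, \<open>F\<^sub>1\<close> of the same
  order, represented by the set of all pairs of such forms that define it. In particular, the
  elements of \<open>PGL\<^sub>2\<close> are the maps \<open>rat_map (L\<^sub>0, L\<^sub>1)\<close> with linearly independent linear forms.
\<close>

definition rat_map :: "'a::field bpoly \<times> 'a bpoly \<Rightarrow> ('a bpoly \<times> 'a bpoly) set" where
  "rat_map \<phi> = {(const c * fst \<phi>, const c * snd \<phi>) | c. c \<noteq> 0}"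

definition comp_map ::
  "'a::field bpoly \<times> 'a bpoly \<Rightarrow> 'a bpoly \<times> 'a bpoly \<Rightarrow> 'a bpoly \<times> 'a bpoly" where
  "comp_map \<phi> \<psi> =
     (bsubst (fst \<phi>) (fst \<psi>) (snd \<psi>), bsubst (snd \<phi>) (fst \<psi>) (snd \<psi>))"

definition lin_det :: "'a::comm_ring_1 bpoly \<Rightarrow> 'a bpoly \<Rightarrow> 'a" where
  "lin_det L\<^sub>0 L\<^sub>1 = bcoeff L\<^sub>0 1 0 * bcoeff L\<^sub>1 0 1 - bcoeff L\<^sub>0 0 1 * bcoeff L\<^sub>1 1 0"

definition GL2 :: "('a::field bpoly \<times> 'a bpoly) set" where
  "GL2 = {(L\<^sub>0, L\<^sub>1). binary_form 1 L\<^sub>0 \<and> binary_form 1 L\<^sub>1 \<and> lin_det L\<^sub>0 L\<^sub>1 \<noteq> 0}"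

definition SL2 :: "('a::field bpoly \<times> 'a bpoly) set" where
  "SL2 = {(L\<^sub>0, L\<^sub>1). binary_form 1 L\<^sub>0 \<and> binary_form 1 L\<^sub>1 \<and> lin_det L\<^sub>0 L\<^sub>1 = 1}"

text \<open>The adjugate, which represents the inverse in \<open>PGL\<^sub>2\<close>.\<close>

definition pgl_inverse :: "'a::field bpoly \<times> 'a bpoly \<Rightarrow> 'a bpoly \<times> 'a bpoly" where
  "pgl_inverse \<gamma> =
     (const (bcoeff (snd \<gamma>) 0 1) * X\<^sub>0 - const (bcoeff (fst \<gamma>) 0 1) * X\<^sub>1,
      const (bcoeff (fst \<gamma>) 1 0) * X\<^sub>1 - const (bcoeff (snd \<gamma>) 1 0) * X\<^sub>0)"

definition Aut :: "'a::field bpoly \<times> 'a bpoly \<Rightarrow> ('a bpoly \<times> 'a bpoly) set set" where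
  "Aut \<phi> = {rat_map \<gamma> | \<gamma>. \<gamma> \<in> GL2 \<and>
     rat_map (comp_map (pgl_inverse \<gamma>) (comp_map \<phi> \<gamma>)) = rat_map \<phi>}"

definition trivial_Aut :: "'a::field bpoly \<times> 'a bpoly \<Rightarrow> bool" where
  "trivial_Aut \<phi> \<longleftrightarrow> Aut \<phi> = {rat_map (X\<^sub>0, X\<^sub>1)}"


subsection \<open>The moduli space inside \<open>P(4,4,4,6)\<close>\<close>

text \<open>
  The point \<open>[s\<^sub>1 : s\<^sub>2 : s\<^sub>3 : r]\<close>, represented by the set of all its weighted homogeneous
  coordinate vectors.
\<close>

definition wpoint ::
  "'a::field \<Rightarrow> 'a \<Rightarrow> 'a \<Rightarrow> 'a \<Rightarrow> ('a \<times> 'a \<times> 'a \<times> 'a) set" where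
  "wpoint s\<^sub>1 s\<^sub>2 s\<^sub>3 r = {(c^4 * s\<^sub>1, c^4 * s\<^sub>2, c^4 * s\<^sub>3, c^6 * r) | c. c \<noteq> 0}"

definition pair_point ::
  "'a::field_char_0 bpoly \<times> 'a bpoly \<Rightarrow> ('a \<times> 'a \<times> 'a \<times> 'a) set" where
  "pair_point = (\<lambda>(f, g). wpoint (inv_s\<^sub>1 f g) (inv_s\<^sub>2 f g) (inv_s\<^sub>3 f g) (inv_r f g))"

text \<open>The geometric points of \<open>M\<^sub>2\<close>, when \<open>'a\<close> is algebraically closed.\<close>

definition M2 :: "('a::field_char_0 \<times> 'a \<times> 'a \<times> 'a) set set" where
  "M2 = {pair_point (pair_of_map \<phi>) | \<phi>. quadratic_map \<phi>}"

text \<open>\<open>M\<^sub>2(k)\<close>: the points of \<open>M\<^sub>2\<close> that have weighted projective coordinates in \<open>k\<close>.\<close>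

definition M2_rational ::
  "('k::field_char_0 alg_closure \<times> 'k alg_closure \<times> 'k alg_closure \<times> 'k alg_closure) set set" where
  "M2_rational = {P \<in> M2. \<exists>s\<^sub>1 s\<^sub>2 s\<^sub>3 r :: 'k.
     P = wpoint (to_ac s\<^sub>1) (to_ac s\<^sub>2) (to_ac s\<^sub>3) (to_ac r)}"

text \<open>
  \<open>v\<close> is the value of the invariant \<open>I\<close> corresponding to the coordinates \<open>s\<^sub>1, s\<^sub>2, s\<^sub>3, r\<close>:
  it is the value of \<open>I\<close> at a pair, defined over the algebraic closure, for which the basic
  invariants are exactly \<open>s\<^sub>1, s\<^sub>2, s\<^sub>3, r\<close> (not just up to weighted scaling). When these are
  coordinates of a point of \<open>M\<^sub>2\<close>, such a pair exists, by scaling.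
\<close>

definition corresponding_value ::
  "('k::field_char_0 alg_closure bpoly \<Rightarrow> 'k alg_closure bpoly \<Rightarrow> 'k alg_closure)
     \<Rightarrow> 'k \<Rightarrow> 'k \<Rightarrow> 'k \<Rightarrow> 'k \<Rightarrow> 'k \<Rightarrow> bool" where
  "corresponding_value I s\<^sub>1 s\<^sub>2 s\<^sub>3 r v \<longleftrightarrow>
     (\<exists>\<phi> f g. quadratic_map \<phi> \<and> pair_of_map \<phi> = (f, g) \<and>
        inv_s\<^sub>1 f g = to_ac s\<^sub>1 \<and> inv_s\<^sub>2 f g = to_ac s\<^sub>2 \<and>
        inv_s\<^sub>3 f g = to_ac s\<^sub>3 \<and> inv_r f g = to_ac r \<and> I f g = to_ac v)"

text \<open>\<open>(-1)\<^sup>i\<close> for \<open>i\<close> in the field with two elements.\<close>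

definition bit_sign :: "bit \<Rightarrow> 'a::comm_ring_1" where
  "bit_sign i = (if i = 0 then 1 else - 1)"


subsection \<open>The sign of the prefactor in the reconstruction formula\<close>

text \<open>
  The factor \<open>9/(2r)\<close> in the formula reconstructing \<open>g\<close> arises from dividing by \<open>(V\<^sub>0, V\<^sub>1)\<^sub>1\<close>.
  With the transvectants normalised as above, \<open>(V\<^sub>0, V\<^sub>1)\<^sub>1 = -r\<close>, so for transformations of
  determinant 1 the factor has to be \<open>-9/(2r)\<close>. With \<open>9/(2r)\<close> one obtains \<open>(f, -g)\<close> instead of
  \<open>(f, g)\<close>, hence the point \<open>[-s\<^sub>1 : s\<^sub>2 : s\<^sub>3 : r]\<close>. The lemmas below show this for the pair
  \<open>(X\<^sub>0, X\<^sub>0\<^sup>3 + X\<^sub>1\<^sup>3)\<close>, which is given by the quadratic map \<open>[X\<^sub>0\<^sup>2/3 + X\<^sub>1\<^sup>2 : X\<^sub>0X\<^sub>1/3 - X\<^sub>0\<^sup>2]\<close>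
  and has \<open>[s\<^sub>1 : s\<^sub>2 : s\<^sub>3 : r] = [-1 : 0 : 2 : 1]\<close>, with \<open>W\<^sub>0 = X\<^sub>0\<close> and \<open>W\<^sub>1 = X\<^sub>1\<close>.
\<close>

context
  fixes f g :: "'a::field_char_0 bpoly" and W :: "bit \<Rightarrow> 'a bpoly"
  defines "f \<equiv> X\<^sub>0" and "g \<equiv> X\<^sub>0 ^ 3 + X\<^sub>1 ^ 3" and "W \<equiv> (\<lambda>i. if i = 0 then X\<^sub>0 else X\<^sub>1)"
begin

private abbreviation rec_f :: "'a bpoly" where
  "rec_f \<equiv> const (inv_b 0 f g) * W 0 - const (inv_b 1 f g) * W 1"

private abbreviation rec_g :: "'a bpoly" where
  "rec_g \<equiv> const (9 / (2 * inv_r f g)) *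
     (\<Sum>i\<in>UNIV. \<Sum>j\<in>UNIV. \<Sum>k\<in>UNIV. bit_sign (i + j + k) *
        const (inv_a i j k f g) * W (i + 1) * W (j + 1) * W (k + 1))"

private lemmas form_eval = transvectant_def atMost_Suc numeral_2_eq_2 numeral_3_eq_3 X\<^sub>0_def X\<^sub>1_def
  const_def pd\<^sub>0_def pd\<^sub>1_def pderiv_pCons map_poly_pCons numeral_poly
  pderiv_add one_pCons fact_numeral bcoeff_def

private lemmas inv_defs = inv_s\<^sub>1_def inv_s\<^sub>2_def inv_s\<^sub>3_def inv_r_def

private lemma H: "cov_H (X\<^sub>0 ^ 3 + X\<^sub>1 ^ 3 :: 'a bpoly) = const 2 * X\<^sub>0 * X\<^sub>1"
  by (simp add: cov_H_def form_eval)

private lemma t: "cov_t (X\<^sub>0 ^ 3 + X\<^sub>1 ^ 3 :: 'a bpoly) = X\<^sub>0 ^ 3 - X\<^sub>1 ^ 3"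
  unfolding cov_t_def H by (simp add: form_eval)

private lemma H': "cov_H (X\<^sub>1 ^ 3 - X\<^sub>0 ^ 3 :: 'a bpoly) = - const 2 * X\<^sub>0 * X\<^sub>1"
  by (simp add: cov_H_def form_eval)

private lemma t': "cov_t (X\<^sub>1 ^ 3 - X\<^sub>0 ^ 3 :: 'a bpoly) = X\<^sub>0 ^ 3 + X\<^sub>1 ^ 3"
  unfolding cov_t_def H' by (simp add: form_eval)

private lemma inv_vals: "inv_s\<^sub>1 f g = - 1" "inv_s\<^sub>2 f g = 0" "inv_s\<^sub>3 f g = 2" "inv_r f g = 1"
  unfolding f_def g_def inv_defs H t by (simp_all add: form_eval)

private lemma inv_vals': "inv_s\<^sub>1 (- X\<^sub>0) (X\<^sub>1 ^ 3 - X\<^sub>0 ^ 3) = (1 :: 'a)"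
  "inv_s\<^sub>2 (- X\<^sub>0) (X\<^sub>1 ^ 3 - X\<^sub>0 ^ 3) = (0 :: 'a)"
  "inv_s\<^sub>3 (- X\<^sub>0) (X\<^sub>1 ^ 3 - X\<^sub>0 ^ 3) = (2 :: 'a)"
  "inv_r (- X\<^sub>0) (X\<^sub>1 ^ 3 - X\<^sub>0 ^ 3) = (1 :: 'a)"
  unfolding inv_defs H' t' by (simp_all add: form_eval)

private lemma UNIV_bit: "(UNIV :: bit set) = {0, 1}"
  by (auto intro: bit.exhaust)

private lemma rec_f: "rec_f = - X\<^sub>0"
  unfolding inv_b_def cov_V\<^sub>0_def cov_V\<^sub>1_def f_def g_def H W_def
  by (simp add: form_eval)

private lemma rec_g: "rec_g = X\<^sub>1 ^ 3 - X\<^sub>0 ^ 3"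
  apply (simp only: UNIV_bit inv_a_def inv_vals[unfolded f_def g_def] Let_def f_def g_def)
  apply (simp add: bit_sign_def W_def)
  apply (simp add: form_eval)
  done

lemma example_map:
  "pair_of_map (const (1/3) * X\<^sub>0 ^ 2 + X\<^sub>1 ^ 2, const (1/3) * X\<^sub>0 * X\<^sub>1 - X\<^sub>0 ^ 2) = (f, g)"
  by (simp add: pair_of_map_def f_def g_def form_eval)

lemma example_wrong_sign: "pair_point (rec_f, rec_g) \<noteq> pair_point (f, g)"
proof
  assume "pair_point (rec_f, rec_g) = pair_point (f, g)"
  then have "wpoint 1 0 2 1 = wpoint (- 1) 0 2 (1 :: 'a)"
    unfolding rec_f rec_g pair_point_def by (simp add: inv_vals inv_vals')
  moreover have "(1, 0, 2, 1) \<in> wpoint 1 0 2 (1 :: 'a)"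
    unfolding wpoint_def by (auto intro!: exI[of _ 1])
  ultimately have "(1, 0, 2, 1) \<in> wpoint (- 1) 0 2 (1 :: 'a)"
    by simp
  then show False
    unfolding wpoint_def by auto
qed

end

end

theory Submission
  imports Defs
begin

text \<open>
  Let \<open>(f, g)\<close> be a pair over the algebraic closure with invariants \<open>s\<^sub>1, s\<^sub>2, s\<^sub>3, r\<close>. The invariants
  \<open>s\<^sub>1\<close>, \<open>s\<^sub>2\<close>, \<open>r\<close> are the determinants of the pairs \<open>(V\<^sub>1, f)\<close>, \<open>(V\<^sub>0, f)\<close>, \<open>(V\<^sub>1, V\<^sub>0)\<close> of linear forms.
  If \<open>r \<noteq> 0\<close>, then \<open>V\<^sub>0, V\<^sub>1\<close> is a basis of the linear forms, and \<open>r f = s\<^sub>1 V\<^sub>0 - s\<^sub>2 V\<^sub>1\<close>. In the same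
  basis
  \[ -r^2 g = G(V_0, V_1), \qquad
     G = -s_1 X_0^3 + \tfrac32 s_2 X_0^2 X_1 - \tfrac12 s_3 X_1^3 . \]
  So the coefficients of \<open>F = s\<^sub>1 X\<^sub>0 - s\<^sub>2 X\<^sub>1\<close> and of \<open>G\<close> depend on the invariants only, and the forms of
  the theorem are \<open>F(W\<^sub>0, W\<^sub>1)\<close> and \<open>G(W\<^sub>0, W\<^sub>1)\<close>. With \<open>\<delta>\<^sup>2 = -r\<close> the substitution by \<open>V\<^sub>0/\<delta>, V\<^sub>1/\<delta>\<close> has
  determinant 1 and takes \<open>(F, G)\<close> to \<open>-\<delta> (f, g)\<close>, so \<open>(F, G)\<close> gives the same moduli point as \<open>(f, g)\<close>;
  another unimodular substitution by \<open>W\<^sub>0, W\<^sub>1\<close> does not move the point.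

  The formal argument evaluates the invariants of \<open>(F, G)\<close> directly, using \<open>2 r\<^sup>2 = s\<^sub>1\<^sup>2 s\<^sub>3 - s\<^sub>2\<^sup>3\<close>:
  they are \<open>\<delta>\<^sup>4 s\<^sub>1\<close>, \<open>\<delta>\<^sup>4 s\<^sub>2\<close>, \<open>\<delta>\<^sup>4 s\<^sub>3\<close>, \<open>\<delta>\<^sup>6 r\<close> (lemma \<open>inv_reconstruction\<close>), and lemma
  \<open>inv_SL2_invariant\<close> allows for the substitution. Two things remain.

  The reconstructed pair must come from a quadratic map. The two components of the map of a pair are
  coprime iff their resultant is nonzero, and \<open>54\<close> times the resultant is \<open>27 s\<^sub>3 - 9 s\<^sub>2 - 2 s\<^sub>1\<close>
  (lemma \<open>resultant_map_of_pair\<close>). This is homogeneous in the coordinates of the point, so it vanishes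
  for the reconstructed pair iff it vanishes for the given one.

  A trivial automorphism group must force \<open>r \<noteq> 0\<close> (lemma \<open>trivial_Aut_imp_inv_r_nonzero\<close>). Let \<open>r = 0\<close>
  and \<open>f \<noteq> 0\<close>. Then the zero of \<open>f\<close> is a zero of \<open>t\<close>, but not of \<open>g\<close> since the resultant is nonzero. So
  it is a fixed point of an involution that permutes the zeros of \<open>g\<close>, and this involution is an
  automorphism. Its other fixed point is the zero
  of \<open>V\<^sub>1\<close>; lemma \<open>involution_of_pair\<close> gives the matrix. If \<open>f = 0\<close>, any zero of \<open>t\<close> can take the place
  of the zero of \<open>f\<close>.
\<close>

section \<open>Binary forms of order at most three\<close>

lemma const_simps:
  "const 0 = 0" "const 1 = 1" "const (- x) = - const x" "const (x * y) = const x * const y"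
  by (simp_all add: const_def one_pCons)

definition lin :: "'a::comm_ring_1 \<Rightarrow> 'a \<Rightarrow> 'a bpoly" where
  "lin p q = const p * X\<^sub>0 + const q * X\<^sub>1"

definition quad :: "'a::comm_ring_1 \<Rightarrow> 'a \<Rightarrow> 'a \<Rightarrow> 'a bpoly" where
  "quad a b c = const a * X\<^sub>0 ^ 2 + const b * X\<^sub>0 * X\<^sub>1 + const c * X\<^sub>1 ^ 2"

text \<open>
  The middle coefficients carry the binomial factor 3, as in classical invariant theory; this keeps
  the transvectants below free of denominators.
\<close>

definition cubic :: "'a::comm_ring_1 \<Rightarrow> 'a \<Rightarrow> 'a \<Rightarrow> 'a \<Rightarrow> 'a bpoly" where
  "cubic a b c d = const a * X\<^sub>0 ^ 3 + const (3 * b) * X\<^sub>0 ^ 2 * X\<^sub>1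
     + const (3 * c) * X\<^sub>0 * X\<^sub>1 ^ 2 + const d * X\<^sub>1 ^ 3"

text \<open>
  The explicit coefficient lists turn every identity between such forms into identities in the
  coefficient ring, which the simplifier can decide.
\<close>

lemma lin_pCons: "lin p q = [:[:0, p:], [:q:]:]"
  by (simp add: lin_def const_def X\<^sub>0_def X\<^sub>1_def)

lemma quad_pCons: "quad a b c = [:[:0, 0, a:], [:0, b:], [:c:]:]"
  by (simp add: quad_def const_def X\<^sub>0_def X\<^sub>1_def power2_eq_square)

lemma cubic_pCons: "cubic a b c d = [:[:0, 0, 0, a:], [:0, 0, 3 * b:], [:0, 3 * c:], [:d:]:]"
  by (simp add: cubic_def const_def X\<^sub>0_def X\<^sub>1_def power2_eq_square power3_eq_cube)

lemmas form_pCons = lin_pCons quad_pCons cubic_pCons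

lemma binary_form_1: "binary_form 1 F \<longleftrightarrow> (\<exists>p q. F = lin p q)"
proof
  assume F: "binary_form 1 F"
  have zero: "i + j \<noteq> 1 \<Longrightarrow> coeff (coeff F j) i = 0" for i j
    using F unfolding binary_form_def bcoeff_def by blast
  have "coeff (coeff F j) i = coeff (coeff (lin (bcoeff F 1 0) (bcoeff F 0 1)) j) i" for i j
    using zero[of i j] by (auto simp: bcoeff_def form_pCons coeff_pCons split: nat.splits)
  then show "\<exists>p q. F = lin p q" by (metis poly_eqI)
qed (auto simp: binary_form_def bcoeff_def form_pCons coeff_pCons split: nat.splits)

lemma binary_form_2: "binary_form 2 F \<longleftrightarrow> (\<exists>a b c. F = quad a b c)"
proof
  assume F: "binary_form 2 F"
  have zero: "i + j \<noteq> 2 \<Longrightarrow> coeff (coeff F j) i = 0" for i j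
    using F unfolding binary_form_def bcoeff_def by blast
  have "coeff (coeff F j) i =
      coeff (coeff (quad (bcoeff F 2 0) (bcoeff F 1 1) (bcoeff F 0 2)) j) i" for i j
    using zero[of i j]
    by (auto simp: bcoeff_def form_pCons coeff_pCons numeral_2_eq_2 split: nat.splits)
  then show "\<exists>a b c. F = quad a b c" by (metis poly_eqI)
qed (auto simp: binary_form_def bcoeff_def form_pCons coeff_pCons split: nat.splits)

lemma binary_form_3:
  fixes F :: "'a::field_char_0 bpoly"
  shows "binary_form 3 F \<longleftrightarrow> (\<exists>a b c d. F = cubic a b c d)"
proof
  assume F: "binary_form 3 F"
  have zero: "i + j \<noteq> 3 \<Longrightarrow> coeff (coeff F j) i = 0" for i j
    using F unfolding binary_form_def bcoeff_def by blast
  have "coeff (coeff F j) i = coeff (coeff (cubic (bcoeff F 3 0) (bcoeff F 2 1 / 3)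
      (bcoeff F 1 2 / 3) (bcoeff F 0 3)) j) i" for i j
    using zero[of i j]
    by (auto simp: bcoeff_def form_pCons coeff_pCons numeral_2_eq_2 numeral_3_eq_3 split: nat.splits)
  then show "\<exists>a b c d. F = cubic a b c d" by (metis poly_eqI)
qed (auto simp: binary_form_def bcoeff_def form_pCons coeff_pCons split: nat.splits)

lemmas form_simps = form_pCons const_def power2_eq_square power3_eq_cube

lemma lin_power2: "lin p q ^ 2 = quad (p^2) (2*p*q) (q^2)"
  by (simp add: form_simps algebra_simps)

lemma lin_power3: "lin p q ^ 3 = cubic (p^3) (p^2*q) (p*q^2) (q^3)"
  by (simp add: form_simps algebra_simps)

lemma lin_det_lin: "lin_det (lin p q) (lin p' q') = p * q' - q * p'"
  by (simp add: lin_det_def bcoeff_def lin_pCons)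

lemma bsubst_lin: "bsubst (lin p q) A B = const p * A + const q * B"
  by (simp add: bsubst_def form_simps map_poly_pCons)

lemma bsubst_quad: "bsubst (quad a b c) A B = const a * A^2 + const b * A * B + const c * B^2"
  by (simp add: bsubst_def form_simps map_poly_pCons algebra_simps)

lemma bsubst_cubic: "bsubst (cubic a b c d) A B =
   const a * A^3 + const (3*b) * A^2 * B + const (3*c) * A * B^2 + const d * B^3"
  by (simp add: bsubst_def form_simps map_poly_pCons algebra_simps)

text \<open>
  The symmetric trilinear form of the cubic; the coefficients of a cubic after a linear substitution
  are its values at the columns of the matrix.
\<close>

definition cubic_polar :: "'a::comm_ring_1 \<Rightarrow> 'a \<Rightarrow> 'a \<Rightarrow> 'a \<Rightarrow>
    'a \<Rightarrow> 'a \<Rightarrow> 'a \<Rightarrow> 'a \<Rightarrow> 'a \<Rightarrow> 'a \<Rightarrow> 'a" where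
  "cubic_polar a b c d x y x' y' x'' y'' = a * x * x' * x''
    + b * (x * x' * y'' + x * y' * x'' + y * x' * x'')
    + c * (x * y' * y'' + y * x' * y'' + y * y' * x'') + d * y * y' * y''"

lemma bsubst_lin_lin: "bsubst (lin p q) (lin u0 v0) (lin u1 v1) = lin (p*u0+q*u1) (p*v0+q*v1)"
  unfolding bsubst_lin by (simp add: form_simps algebra_simps)

lemma bsubst_quad_lin: "bsubst (quad a b c) (lin u0 v0) (lin u1 v1) =
  quad (a*u0^2+b*u0*u1+c*u1^2) (2*a*u0*v0+b*(u0*v1+v0*u1)+2*c*u1*v1) (a*v0^2+b*v0*v1+c*v1^2)"
  unfolding bsubst_quad by (simp add: form_simps algebra_simps)

lemma bsubst_cubic_lin: "bsubst (cubic a b c d) (lin u0 v0) (lin u1 v1) =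
  cubic (cubic_polar a b c d u0 u1 u0 u1 u0 u1) (cubic_polar a b c d u0 u1 u0 u1 v0 v1)
    (cubic_polar a b c d u0 u1 v0 v1 v0 v1) (cubic_polar a b c d v0 v1 v0 v1 v0 v1)"
  unfolding bsubst_cubic by (simp add: form_simps cubic_polar_def algebra_simps)

section \<open>The invariants in terms of coefficients\<close>

lemma pd_lin: "pd\<^sub>0 (lin p q) = const p" "pd\<^sub>1 (lin p q) = const q"
  by (simp_all add: pd\<^sub>0_def pd\<^sub>1_def form_simps pderiv_pCons map_poly_pCons)

lemma pd_quad: "pd\<^sub>0 (quad a b c) = lin (2*a) b" "pd\<^sub>1 (quad a b c) = lin b (2*c)"
  by (simp_all add: pd\<^sub>0_def pd\<^sub>1_def form_simps pderiv_pCons map_poly_pCons)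

lemma pd_cubic: "pd\<^sub>0 (cubic a b c d) = quad (3*a) (6*b) (3*c)"
   "pd\<^sub>1 (cubic a b c d) = quad (3*b) (6*c) (3*d)"
  by (simp_all add: pd\<^sub>0_def pd\<^sub>1_def form_simps pderiv_pCons map_poly_pCons)

lemmas transvectant_simps = transvectant_def atMost_Suc pd_lin pd_quad pd_cubic
  numeral_2_eq_2 numeral_3_eq_3 fact_numeral
lemmas ring_simps = form_simps numeral_poly field_simps

context
  fixes a b c d e p q :: "'a::field_char_0"
begin

lemma transvectant_lin_lin:
  "transvectant 1 1 1 (lin a b) (lin p q) = const (a * q - b * p)"
  by (simp add: transvectant_simps) (simp add: ring_simps)

lemma transvectant_quad_lin:
  "transvectant 2 1 1 (quad a (2 * b) c) (lin p q) = lin (a * q - b * p) (b * q - c * p)"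
  by (simp add: transvectant_simps) (simp add: ring_simps)

lemma transvectant_quad_quad:
  "transvectant 2 2 2 (quad a (2 * b) c) (quad d (2 * e) f) = const (a * f - 2 * b * e + c * d)"
  by (simp add: transvectant_simps) (simp add: ring_simps)

lemma transvectant_cubic_quad:
  "transvectant 3 2 2 (cubic a b c d) (quad p (2 * q) e) =
     lin (a * e - 2 * b * q + c * p) (b * e - 2 * c * q + d * p)"
  by (simp add: transvectant_simps) (simp add: ring_simps)

lemma transvectant_cubic_cubic:
  "transvectant 3 3 3 (cubic a b c d) (cubic a' b' c' d') =
     const (a * d' - 3 * b * c' + 3 * c * b' - d * a')"
  by (simp add: transvectant_simps) (simp add: ring_simps)

end

context
  fixes a b c d p q :: "'a::field_char_0"
begin

lemma cov_H_cubic: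
  "cov_H (cubic a b c d) = quad (2 * (a*c - b^2)) (2 * (a*d - b*c)) (2 * (b*d - c^2))"
  unfolding cov_H_def by (simp add: transvectant_simps) (simp add: ring_simps)

lemma cov_t_cubic:
  "cov_t (cubic a b c d) = cubic (a^2*d - 3*a*b*c + 2*b^3) (a*b*d - 2*a*c^2 + b^2*c)
     (2*b^2*d - b*c^2 - a*c*d) (3*b*c*d - 2*c^3 - a*d^2)"
  unfolding cov_t_def cov_H_cubic by (simp add: transvectant_simps) (simp add: ring_simps)

lemma bcoeff_const: "bcoeff (const x) 0 0 = x"
  by (simp add: bcoeff_def const_def)

lemma inv_s1_eq: "inv_s\<^sub>1 (lin p q) (cubic a b c d) = a*q^3 - 3*b*p*q^2 + 3*c*p^2*q - d*p^3"
  by (simp add: inv_s\<^sub>1_def lin_power3 transvectant_cubic_cubic bcoeff_const algebra_simps)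

lemma inv_s2_eq: "inv_s\<^sub>2 (lin p q) (cubic a b c d) =
   2 * ((a*c - b^2) * q^2 - (a*d - b*c) * p * q + (b*d - c^2) * p^2)"
  unfolding inv_s\<^sub>2_def lin_power2 cov_H_cubic mult.assoc[of 2 p q] transvectant_quad_quad
    bcoeff_const
  by (simp add: algebra_simps)

lemma inv_s3_eq: "inv_s\<^sub>3 (lin p q) (cubic a b c d) =
   2 * ((a*d - b*c)^2 - 4 * (a*c - b^2) * (b*d - c^2))"
  unfolding inv_s\<^sub>3_def cov_t_cubic transvectant_cubic_cubic bcoeff_const
  by (simp add: algebra_simps power2_eq_square power3_eq_cube)

lemma inv_r_eq: "inv_r (lin p q) (cubic a b c d) =
   (a^2*d - 3*a*b*c + 2*b^3) * q^3 - 3 * (a*b*d - 2*a*c^2 + b^2*c) * p * q^2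
     + 3 * (2*b^2*d - b*c^2 - a*c*d) * p^2 * q - (3*b*c*d - 2*c^3 - a*d^2) * p^3"
  unfolding inv_r_def cov_t_cubic lin_power3 transvectant_cubic_cubic bcoeff_const
  by (simp add: algebra_simps power2_eq_square power3_eq_cube)

lemma cov_V0_eq: "cov_V\<^sub>0 (lin p q) (cubic a b c d) =
    lin (2*(a*c - b^2)*q - (a*d - b*c)*p) ((a*d - b*c)*q - 2*(b*d - c^2)*p)"
  unfolding cov_V\<^sub>0_def cov_H_cubic transvectant_quad_lin by simp

lemma cov_V1_eq: "cov_V\<^sub>1 (lin p q) (cubic a b c d) =
    lin (a*q^2 - 2*b*p*q + c*p^2) (b*q^2 - 2*c*p*q + d*p^2)"
  unfolding cov_V\<^sub>1_def lin_power2 mult.assoc[of 2 p q] transvectant_cubic_quad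
  by (simp add: algebra_simps)

text \<open>
  The invariants \<open>s\<^sub>1\<close>, \<open>s\<^sub>2\<close>, \<open>r\<close> are the three \<open>2 \<times> 2\<close> determinants of the linear covariants
  \<open>V\<^sub>1\<close>, \<open>V\<^sub>0\<close>, \<open>f\<close>. For \<open>r \<noteq> 0\<close> this expresses \<open>f\<close> in the basis \<open>V\<^sub>0, V\<^sub>1\<close> by Cramer's rule, and it
  reduces the invariance of \<open>s\<^sub>1\<close>, \<open>s\<^sub>2\<close>, \<open>r\<close> to the covariance of \<open>V\<^sub>0\<close> and \<open>V\<^sub>1\<close>.
\<close>

lemma inv_s1_det: "inv_s\<^sub>1 (lin p q) (cubic a b c d) =
    lin_det (cov_V\<^sub>1 (lin p q) (cubic a b c d)) (lin p q)"
  unfolding inv_s1_eq cov_V1_eq lin_det_lin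
  by (simp add: algebra_simps power2_eq_square power3_eq_cube)

lemma inv_s2_det: "inv_s\<^sub>2 (lin p q) (cubic a b c d) =
    lin_det (cov_V\<^sub>0 (lin p q) (cubic a b c d)) (lin p q)"
  unfolding inv_s2_eq cov_V0_eq lin_det_lin
  by (simp add: algebra_simps power2_eq_square power3_eq_cube)

lemma inv_r_det: "inv_r (lin p q) (cubic a b c d) =
    lin_det (cov_V\<^sub>1 (lin p q) (cubic a b c d)) (cov_V\<^sub>0 (lin p q) (cubic a b c d))"
  unfolding inv_r_eq cov_V0_eq cov_V1_eq lin_det_lin
  by (simp add: algebra_simps power2_eq_square power3_eq_cube)

lemma inv_b0_eq: "inv_b 0 (lin p q) (cubic a b c d) = inv_s\<^sub>1 (lin p q) (cubic a b c d)"
  unfolding inv_s1_eq inv_b_def cov_V1_eq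
  by (simp add: transvectant_lin_lin[unfolded One_nat_def] bcoeff_const algebra_simps
      power3_eq_cube power2_eq_square)

lemma inv_b1_eq: "inv_b 1 (lin p q) (cubic a b c d) = inv_s\<^sub>2 (lin p q) (cubic a b c d)"
  unfolding inv_s2_eq inv_b_def cov_V0_eq
  by (simp add: transvectant_lin_lin[unfolded One_nat_def] bcoeff_const algebra_simps
      power3_eq_cube power2_eq_square)

lemma inv_relation:
  "2 * inv_r (lin p q) (cubic a b c d) ^ 2 = inv_s\<^sub>1 (lin p q) (cubic a b c d) ^ 2 *
    inv_s\<^sub>3 (lin p q) (cubic a b c d) - inv_s\<^sub>2 (lin p q) (cubic a b c d) ^ 3"
  unfolding inv_s1_eq inv_s2_eq inv_s3_eq inv_r_eq
  by (simp add: algebra_simps power2_eq_square power3_eq_cube)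

end

section \<open>Invariance under unimodular substitutions\<close>

lemma lin_det_bsubst:
  assumes "binary_form 1 L" "binary_form 1 M" "binary_form 1 A" "binary_form 1 B"
  shows "lin_det (bsubst L A B) (bsubst M A B) = lin_det L M * lin_det A B"
  using assms unfolding binary_form_1
  by (auto simp: bsubst_lin_lin lin_det_lin algebra_simps)

text \<open>
  The identities below hold because a power of the determinant splits off; the proofs exhibit this
  factor before setting it to 1. Going through the intermediate covariants keeps the expansions
  small: the polynomial identity of degree 18 behind the invariance of \<open>r\<close> is never expanded.
\<close>

locale SL2_transformation =
  fixes p q a b c d u0 u1 v0 v1 :: "'a::field_char_0"
  assumes det: "u0 * v1 - v0 * u1 = 1"
begin

abbreviation "W0 \<equiv> lin u0 v0"
abbreviation "W1 \<equiv> lin u1 v1"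
abbreviation "f \<equiv> lin p q"
abbreviation "g \<equiv> cubic a b c d"

abbreviation "A \<equiv> cubic_polar a b c d u0 u1 u0 u1 u0 u1"
abbreviation "B \<equiv> cubic_polar a b c d u0 u1 u0 u1 v0 v1"
abbreviation "C \<equiv> cubic_polar a b c d u0 u1 v0 v1 v0 v1"
abbreviation "D \<equiv> cubic_polar a b c d v0 v1 v0 v1 v0 v1"

lemma hessian_bsubst:
  shows "A*C-B^2 = (a*c-b^2)*u0^2 + (a*d-b*c)*u0*u1 + (b*d-c^2)*u1^2"
    and "A*D-B*C = 2*(a*c-b^2)*u0*v0 + (a*d-b*c)*(u0*v1+u1*v0) + 2*(b*d-c^2)*u1*v1"
    and "B*D-C^2 = (a*c-b^2)*v0^2 + (a*d-b*c)*v0*v1 + (b*d-c^2)*v1^2"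
proof -
  have "A*C-B^2 = (u0 * v1 - v0 * u1)^2 * ((a*c-b^2)*u0^2 + (a*d-b*c)*u0*u1 + (b*d-c^2)*u1^2)"
    unfolding cubic_polar_def by (simp add: algebra_simps power2_eq_square power3_eq_cube)
  then show "A*C-B^2 = (a*c-b^2)*u0^2 + (a*d-b*c)*u0*u1 + (b*d-c^2)*u1^2"
    by (simp add: det)
  have "A*D-B*C = (u0 * v1 - v0 * u1)^2 * (2*(a*c-b^2)*u0*v0 + (a*d-b*c)*(u0*v1+u1*v0) + 2*(b*d-c^2)*u1*v1)"
    unfolding cubic_polar_def by (simp add: algebra_simps power2_eq_square power3_eq_cube)
  then show "A*D-B*C = 2*(a*c-b^2)*u0*v0 + (a*d-b*c)*(u0*v1+u1*v0) + 2*(b*d-c^2)*u1*v1"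
    by (simp add: det)
  have "B*D-C^2 = (u0 * v1 - v0 * u1)^2 * ((a*c-b^2)*v0^2 + (a*d-b*c)*v0*v1 + (b*d-c^2)*v1^2)"
    unfolding cubic_polar_def by (simp add: algebra_simps power2_eq_square power3_eq_cube)
  then show "B*D-C^2 = (a*c-b^2)*v0^2 + (a*d-b*c)*v0*v1 + (b*d-c^2)*v1^2"
    by (simp add: det)
qed

lemma cov_V0_bsubst: "cov_V\<^sub>0 (bsubst f W0 W1) (bsubst g W0 W1) = bsubst (cov_V\<^sub>0 f g) W0 W1"
proof -
  define x y z where "x = a*c-b^2" and "y = a*d-b*c" and "z = b*d-c^2"
  have "cov_V\<^sub>0 (bsubst f W0 W1) (bsubst g W0 W1) =
    lin ((u0 * v1 - v0 * u1) * ((2*x*q - y*p)*u0 + (y*q-2*z*p)*u1))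
     ((u0 * v1 - v0 * u1) * ((2*x*q - y*p)*v0 + (y*q-2*z*p)*v1))"
    unfolding bsubst_lin_lin bsubst_cubic_lin cov_V0_eq hessian_bsubst
    unfolding x_def[symmetric] y_def[symmetric] z_def[symmetric]
    by (simp add: algebra_simps power2_eq_square power3_eq_cube)
  then show ?thesis
    by (simp only: det mult_1_left cov_V0_eq bsubst_lin_lin x_def y_def z_def)
qed

lemma cov_V1_bsubst: "cov_V\<^sub>1 (bsubst f W0 W1) (bsubst g W0 W1) = bsubst (cov_V\<^sub>1 f g) W0 W1"
proof -
  have "cov_V\<^sub>1 (bsubst f W0 W1) (bsubst g W0 W1) =
    lin ((u0 * v1 - v0 * u1)^2 * ((a*q^2 - 2*b*p*q + c*p^2)*u0 + (b*q^2 - 2*c*p*q + d*p^2)*u1))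
     ((u0 * v1 - v0 * u1)^2 * ((a*q^2 - 2*b*p*q + c*p^2)*v0 + (b*q^2 - 2*c*p*q + d*p^2)*v1))"
    unfolding bsubst_lin_lin bsubst_cubic_lin cov_V1_eq cubic_polar_def
    by (simp add: algebra_simps power2_eq_square power3_eq_cube)
  then show ?thesis by (simp add: det cov_V1_eq bsubst_lin_lin)
qed

lemma inv_s3_bsubst: "inv_s\<^sub>3 (bsubst f W0 W1) (bsubst g W0 W1) = inv_s\<^sub>3 f g"
proof -
  define x y z where "x = a*c-b^2" and "y = a*d-b*c" and "z = b*d-c^2"
  have "inv_s\<^sub>3 (bsubst f W0 W1) (bsubst g W0 W1) = (u0 * v1 - v0 * u1)^2 * (2*(y^2-4*x*z))"
    unfolding bsubst_lin_lin bsubst_cubic_lin inv_s3_eq hessian_bsubst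
    unfolding x_def[symmetric] y_def[symmetric] z_def[symmetric]
    by (simp add: algebra_simps power2_eq_square power3_eq_cube)
  then show ?thesis by (simp add: det inv_s3_eq x_def y_def z_def)
qed

end

lemma inv_SL2_invariant:
  fixes f g :: "'a::field_char_0 bpoly"
  assumes f: "binary_form 1 f" and g: "binary_form 3 g" and W: "(T0, T1) \<in> SL2"
  shows "inv_s\<^sub>1 (bsubst f T0 T1) (bsubst g T0 T1) = inv_s\<^sub>1 f g"
    and "inv_s\<^sub>2 (bsubst f T0 T1) (bsubst g T0 T1) = inv_s\<^sub>2 f g"
    and "inv_s\<^sub>3 (bsubst f T0 T1) (bsubst g T0 T1) = inv_s\<^sub>3 f g"
    and "inv_r (bsubst f T0 T1) (bsubst g T0 T1) = inv_r f g"
proof -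
  obtain p q a b c d u0 v0 u1 v1 where
    eqs: "f = lin p q" "g = cubic a b c d" "T0 = lin u0 v0" "T1 = lin u1 v1"
    using f g W unfolding SL2_def binary_form_1 binary_form_3 by blast
  have "lin_det (lin u0 v0) (lin u1 v1) = 1"
    using W by (simp add: SL2_def eqs)
  then interpret SL2_transformation p q a b c d u0 u1 v0 v1
    by unfold_locales (simp add: lin_det_lin)
  obtain P Q A B C D where subst: "bsubst f T0 T1 = lin P Q" "bsubst g T0 T1 = cubic A B C D"
    unfolding eqs bsubst_lin_lin bsubst_cubic_lin by blast
  have bf: "binary_form 1 (lin x y)" for x y :: 'a
    unfolding binary_form_1 by blast
  have ld: "lin_det (bsubst (lin x y) T0 T1) (bsubst (lin x' y') T0 T1) = lin_det (lin x y) (lin x' y')"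
    for x y x' y'
    using det by (subst lin_det_bsubst) (simp_all add: bf[unfolded One_nat_def] eqs lin_det_lin)
  show "inv_s\<^sub>1 (bsubst f T0 T1) (bsubst g T0 T1) = inv_s\<^sub>1 f g"
    using cov_V1_bsubst ld inv_s1_det[of P Q A B C D] unfolding subst[symmetric] eqs inv_s1_det
    by (simp add: cov_V1_eq)
  show "inv_s\<^sub>2 (bsubst f T0 T1) (bsubst g T0 T1) = inv_s\<^sub>2 f g"
    using cov_V0_bsubst ld inv_s2_det[of P Q A B C D] unfolding subst[symmetric] eqs inv_s2_det
    by (simp add: cov_V0_eq)
  show "inv_s\<^sub>3 (bsubst f T0 T1) (bsubst g T0 T1) = inv_s\<^sub>3 f g"
    unfolding eqs by (rule inv_s3_bsubst)
  show "inv_r (bsubst f T0 T1) (bsubst g T0 T1) = inv_r f g"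
    using cov_V0_bsubst cov_V1_bsubst ld inv_r_det[of P Q A B C D]
    unfolding subst[symmetric] eqs inv_r_det
    by (simp add: cov_V0_eq cov_V1_eq)
qed

section \<open>Quadratic maps and their resultant\<close>

definition resultant_quad :: "'a::comm_ring_1 \<Rightarrow> 'a \<Rightarrow> 'a \<Rightarrow> 'a \<Rightarrow> 'a \<Rightarrow> 'a \<Rightarrow> 'a" where
  "resultant_quad a b c a' b' c' =
     (a * c' - c * a')^2 - (a * b' - b * a') * (b * c' - c * b')"

lemma bcoeff_0_0_mult: "bcoeff (F * G) 0 0 = bcoeff F 0 0 * bcoeff G 0 0"
  by (simp add: bcoeff_def coeff_mult_0)

text \<open>
  Taking the constant coefficient is multiplicative, so it maps units to units.
\<close>

lemma not_unit_form:
  assumes "bcoeff F 0 0 = 0"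
  shows "\<not> is_unit F"
proof
  assume "is_unit F"
  then obtain G where "1 = F * G" by (elim dvdE)
  then have "bcoeff 1 0 0 = bcoeff F 0 0 * bcoeff G 0 0" by (metis bcoeff_0_0_mult)
  then show False using assms by (simp add: bcoeff_def)
qed

text \<open>
  The adjugate of the Sylvester matrix writes the resultant times \<open>X\<^sub>0\<^sup>3\<close>, and times \<open>X\<^sub>1\<^sup>3\<close>, as a
  combination of the two quadratic forms. A common divisor therefore divides multiples of
  \<open>X\<^sub>0\<^sup>3\<close> and of \<open>X\<^sub>1\<^sup>3\<close> by nonzero constants, hence is constant.
\<close>

lemma coprime_quadI:
  fixes a b c a' b' c' :: "'a::field"
  assumes res: "resultant_quad a b c a' b' c' \<noteq> 0"
  shows "coprime (quad a b c) (quad a' b' c')"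
proof (rule coprimeI)
  fix D assume D: "D dvd quad a b c" "D dvd quad a' b' c'"
  define R M N K where "R = resultant_quad a b c a' b' c'"
    and "M = a * b' - b * a'" and "N = a * c' - c * a'" and "K = b * c' - c * b'"
  have R: "R = N^2 - M * K" by (simp add: R_def M_def N_def K_def resultant_quad_def)
  \<comment> \<open>The coefficients of the linear multipliers are cofactors of the \<open>4 \<times> 4\<close> Sylvester matrix.\<close>
  have "const R * X\<^sub>0^3 = lin (N*c' - K*b') (- K*c') * quad a b c + lin (K*b - N*c) (K*c) * quad a' b' c'"
    unfolding R by (simp add: form_simps X\<^sub>0_def M_def N_def K_def algebra_simps)
  then have "D dvd const R * X\<^sub>0^3"
    using D by simp
  then have D0: "D dvd [:[:0, 0, 0, R:]:]"
    by (simp add: form_simps X\<^sub>0_def)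
  have "const R * X\<^sub>1^3 = lin (M*a') (M*b' - N*a') * quad a b c + lin (- M*a) (N*a - M*b) * quad a' b' c'"
    unfolding R by (simp add: form_simps X\<^sub>1_def M_def N_def K_def algebra_simps)
  then have "D dvd const R * X\<^sub>1^3"
    using D by simp
  then have D1: "D dvd [:0, 0, 0, [:R:]:]"
    by (simp add: form_simps X\<^sub>1_def)
  have "R \<noteq> 0" using res by (simp add: R_def)
  then have "degree D = 0"
    using dvd_imp_degree_le[OF D0] by simp
  then obtain E where E: "D = [:E:]" using degree_eq_zeroE by blast
  have "E dvd coeff [:0, 0, 0, [:R:]:] 3"
    using D1 unfolding E const_poly_dvd_iff by blast
  then have "E dvd [:R:]" by (simp add: numeral_3_eq_3)
  moreover have "is_unit [:R:]" using \<open>R \<noteq> 0\<close>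
    by (simp add: is_unit_const_poly_iff dvd_field_iff)
  ultimately have "is_unit E" by (rule dvd_trans)
  then show "is_unit D" by (simp add: E is_unit_const_poly_iff)
qed

lemma quad_factorization:
  fixes a b c :: "'a::alg_closed_field"
  obtains l m l' m' where "quad a b c = lin l m * lin l' m'"
proof (cases "a = 0")
  case True
  then have "quad a b c = lin 0 1 * lin b c" by (simp add: form_simps)
  then show ?thesis by (rule that)
next
  case False
  then obtain z where z: "poly [:c, b, a:] z = 0"
    using alg_closed_imp_poly_has_root[of "[:c, b, a:]"] by auto
  then have "c = - z * (b + a * z)" by (simp add: add_eq_0_iff2)
  then have "quad a b c = lin 1 (- z) * lin a (b + a * z)" by (simp add: form_simps algebra_simps)
  then show ?thesis by (rule that)
qed

text \<open>
  The hypothesis says that \<open>(m, -l)\<close>, the zero of the linear form, is a zero of the quadratic form.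
\<close>

lemma lin_dvd_quad:
  fixes a b c :: "'a::field"
  assumes nz: "l \<noteq> 0 \<or> m \<noteq> 0" and root: "a * m^2 - b * l * m + c * l^2 = 0"
  shows "lin l m dvd quad a b c"
proof (cases "m = 0")
  case True
  with assms have "quad a b c = lin l m * lin (a / l) (b / l)" by (simp add: form_simps)
  then show ?thesis by (rule dvdI)
next
  case False
  have "a * m^2 = b * l * m - c * l^2" using root by (simp add: algebra_simps)
  then have "a = l * ((b - l * (c / m)) / m)" using False by (simp add: field_simps power2_eq_square)
  with False have "quad a b c = lin l m * lin ((b - l * (c / m)) / m) (c / m)"
    by (simp add: form_simps)
  then show ?thesis by (rule dvdI)
qed

text \<open>
  Over an algebraically closed field the first form splits into two linear factors, and the resultant
  is the product of the values of the second form at their zeros.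
\<close>

lemma coprime_quadD:
  fixes a b c a' b' c' :: "'a::alg_closed_field"
  assumes cop: "coprime (quad a b c) (quad a' b' c')"
  shows "resultant_quad a b c a' b' c' \<noteq> 0"
proof
  assume res: "resultant_quad a b c a' b' c' = 0"
  obtain l m l' m' where fac: "quad a b c = lin l m * lin l' m'" by (rule quad_factorization)
  then have abc: "a = l * l'" "b = l * m' + m * l'" "c = m * m'"
    by (auto simp: form_simps algebra_simps)
  have "resultant_quad a b c a' b' c' =
      (a' * m^2 - b' * l * m + c' * l^2) * (a' * m'^2 - b' * l' * m' + c' * l'^2)"
    by (simp add: resultant_quad_def abc algebra_simps power2_eq_square)
  with res have disj: "a' * m^2 - b' * l * m + c' * l^2 = 0 \<or> a' * m'^2 - b' * l' * m' + c' * l'^2 = 0"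
    by simp
  have nonunit: "\<not> is_unit (lin x y)" "\<not> is_unit (quad x y z)" for x y z :: 'a
    by (rule not_unit_form, simp add: bcoeff_def form_pCons)+
  show False
  proof (cases "quad a b c = 0")
    case True
    then have "is_unit (quad a' b' c')" using cop by simp
    then show False using nonunit by simp
  next
    case False
    then have nz: "l \<noteq> 0 \<or> m \<noteq> 0" "l' \<noteq> 0 \<or> m' \<noteq> 0" unfolding fac by (auto simp: lin_pCons)
    from disj have "lin l m dvd quad a' b' c' \<or> lin l' m' dvd quad a' b' c'"
      using lin_dvd_quad[OF nz(1)] lin_dvd_quad[OF nz(2)] by blast
    then obtain x y where "lin x y dvd quad a b c" "lin x y dvd quad a' b' c'"
      unfolding fac by (metis dvd_triv_left dvd_triv_right)
    then have "is_unit (lin x y)" using cop coprime_common_divisor by blast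
    then show False using nonunit by simp
  qed
qed

text \<open>
  The inverse of \<^const>\<open>pair_of_map\<close>. By Euler's formula
  \<open>3 F\<^sub>0 = \<partial>g/\<partial>X\<^sub>1 + X\<^sub>0 f\<close> and \<open>3 F\<^sub>1 = - \<partial>g/\<partial>X\<^sub>0 + X\<^sub>1 f\<close>.
\<close>

definition map_of_pair :: "'a::field_char_0 \<Rightarrow> 'a \<Rightarrow> 'a \<Rightarrow> 'a \<Rightarrow> 'a \<Rightarrow> 'a \<Rightarrow> 'a bpoly \<times> 'a bpoly" where
  "map_of_pair p q a b c d =
    (quad (b + p / 3) (2 * c + q / 3) d, quad (- a) (p / 3 - 2 * b) (q / 3 - c))"

lemma pair_of_map_of_pair: "pair_of_map (map_of_pair p q a b c d) = (lin p q, cubic a b c d)"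
  by (simp add: pair_of_map_def map_of_pair_def pd_quad) (simp add: ring_simps X\<^sub>0_def X\<^sub>1_def)

lemma map_of_pair_surj:
  assumes "binary_form 2 F" "binary_form 2 G"
  obtains p q a b c d where "(F, G) = map_of_pair p q a b c d"
proof -
  obtain a0 a1 a2 b0 b1 b2 where "F = quad a0 a1 a2" "G = quad b0 b1 b2"
    using assms unfolding binary_form_2 by blast
  then have "(F, G) = map_of_pair (2*a0+b1) (a1+2*b2) (-b0) ((a0-b1)/3) ((a1-b2)/3) a2"
    by (simp add: map_of_pair_def form_pCons field_simps)
  then show ?thesis by (rule that)
qed

text \<open>
  The resultant of \<open>F\<^sub>0\<close> and \<open>F\<^sub>1\<close> is an invariant of degree 4 of the pair, hence a linear combination of
  \<open>s\<^sub>1\<close>, \<open>s\<^sub>2\<close>, \<open>s\<^sub>3\<close>; the factor 54 clears the denominators. So whether a pair comes from a quadratic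
  map can be read off from its moduli point.
\<close>

definition inv_resultant :: "'a::field_char_0 bpoly \<Rightarrow> 'a bpoly \<Rightarrow> 'a" where
  "inv_resultant f g = 27 * inv_s\<^sub>3 f g - 9 * inv_s\<^sub>2 f g - 2 * inv_s\<^sub>1 f g"

lemma resultant_map_of_pair:
  "54 * resultant_quad (b + p / 3) (2 * c + q / 3) d (- a) (p / 3 - 2 * b) (q / 3 - c) =
   inv_resultant (lin p q) (cubic a b c d)"
proof -
  define p' q' where "p' = p / 3" and "q' = q / 3"
  have pq: "p = 3 * p'" "q = 3 * q'" by (simp_all add: p'_def q'_def)
  show ?thesis
    unfolding pq inv_resultant_def inv_s1_eq inv_s2_eq inv_s3_eq resultant_quad_def
    by (simp add: algebra_simps power2_eq_square power3_eq_cube)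
qed

lemma quadratic_map_of_pairI:
  assumes "inv_resultant (lin p q) (cubic a b c d) \<noteq> 0"
  shows "quadratic_map (map_of_pair p q a b c d)"
proof -
  have "resultant_quad (b + p / 3) (2 * c + q / 3) d (- a) (p / 3 - 2 * b) (q / 3 - c) \<noteq> 0"
    using assms unfolding resultant_map_of_pair[symmetric] by simp
  then show ?thesis unfolding quadratic_map_def map_of_pair_def
    by (auto simp: binary_form_2 intro: coprime_quadI)
qed

lemma quadratic_mapE:
  fixes \<phi> :: "'a::{alg_closed_field, field_char_0} bpoly \<times> 'a bpoly"
  assumes "quadratic_map \<phi>"
  obtains p q a b c d where "\<phi> = map_of_pair p q a b c d"
    "inv_resultant (lin p q) (cubic a b c d) \<noteq> 0"
proof -
  have "binary_form 2 (fst \<phi>)" "binary_form 2 (snd \<phi>)"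
    using assms by (simp_all add: quadratic_map_def)
  then obtain p q a b c d where "(fst \<phi>, snd \<phi>) = map_of_pair p q a b c d"
    by (rule map_of_pair_surj)
  then have \<phi>: "\<phi> = map_of_pair p q a b c d" by simp
  have "coprime (quad (b + p / 3) (2 * c + q / 3) d) (quad (- a) (p / 3 - 2 * b) (q / 3 - c))"
    using assms unfolding quadratic_map_def \<phi> map_of_pair_def by simp
  from coprime_quadD[OF this] have
    "54 * resultant_quad (b + p / 3) (2 * c + q / 3) d (- a) (p / 3 - 2 * b) (q / 3 - c) \<noteq> 0"
    by simp
  then show ?thesis
    using that[OF \<phi>] unfolding resultant_map_of_pair by blast
qed

section \<open>Quadratic maps without automorphisms\<close>

text \<open>
  Conjugation by \<open>\<gamma>\<close> acts on pairs by substitution, up to the factor \<open>D = det \<gamma>\<close> on the linear form.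
  Hence \<open>\<gamma>\<close> is an automorphism as soon as \<open>D (f \<circ> \<gamma>)\<close> and \<open>g \<circ> \<gamma>\<close> are the same nonzero multiple
  of \<open>f\<close> and \<open>g\<close>.
\<close>

lemma conj_map_of_pair:
  fixes u0 u1 v0 v1 :: "'a::field_char_0"
  defines "\<gamma> \<equiv> (lin u0 v0, lin u1 v1)" and "D \<equiv> u0 * v1 - v0 * u1"
  shows "comp_map (pgl_inverse \<gamma>) (comp_map (map_of_pair p q a b c d) \<gamma>) =
    map_of_pair (D * (p * u0 + q * u1)) (D * (p * v0 + q * v1))
     (cubic_polar a b c d u0 u1 u0 u1 u0 u1) (cubic_polar a b c d u0 u1 u0 u1 v0 v1)
    (cubic_polar a b c d u0 u1 v0 v1 v0 v1) (cubic_polar a b c d v0 v1 v0 v1 v0 v1)"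
proof -
  define p' q' where "p' = p / 3" and "q' = q / 3"
  have pq: "p = 3 * p'" "q = 3 * q'" by (simp_all add: p'_def q'_def)
  have inv: "pgl_inverse \<gamma> = (lin v1 (- v0), lin (- u1) u0)"
    by (simp add: pgl_inverse_def \<gamma>_def bcoeff_def form_simps X\<^sub>0_def X\<^sub>1_def)
  have comb: "const x * quad a b c + const y * quad a' b' c' =
      quad (x * a + y * a') (x * b + y * b') (x * c + y * c')" for x y a b c a' b' c' :: 'a
    by (simp add: form_simps)
  have quad_cong: "x = x' \<Longrightarrow> y = y' \<Longrightarrow> z = z' \<Longrightarrow> quad x y z = quad x' y' z'" for x y z x' y' z' :: 'a
    by simp
  have triple: "map_of_pair (3 * x) (3 * y) a b c d =
      (quad (b + x) (2 * c + y) d, quad (- a) (x - 2 * b) (y - c))" for x y a b c d :: 'a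
    by (simp add: map_of_pair_def)
  have pq': "D * (p * u0 + q * u1) = 3 * (D * (p' * u0 + q' * u1))"
    "D * (p * v0 + q * v1) = 3 * (D * (p' * v0 + q' * v1))"
    by (simp_all add: pq algebra_simps)
  show ?thesis
    unfolding inv pq' unfolding comp_map_def \<gamma>_def fst_conv snd_conv bsubst_quad_lin
     bsubst_lin comb D_def pq triple cubic_polar_def
    by (intro arg_cong2[where f = Pair] quad_cong)
      (simp_all add: algebra_simps power2_eq_square power3_eq_cube)
qed

lemma map_of_pair_scale:
  "map_of_pair (e * p) (e * q) (e * a) (e * b) (e * c) (e * d) =
    (const e * fst (map_of_pair p q a b c d), const e * snd (map_of_pair p q a b c d))"
  by (simp add: map_of_pair_def form_simps algebra_simps)

lemma rat_map_scale:
  assumes "e \<noteq> 0"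
  shows "rat_map (const e * F, const e * G) = rat_map (F, G)"
proof -
  have "\<exists>c'. (const c * (const e * F), const c * (const e * G)) = (const c' * F, const c' * G) \<and> c' \<noteq> 0"
    if "c \<noteq> 0" for c
    using that assms by (intro exI[of _ "c * e"]) (simp add: const_simps(4) mult.assoc)
  moreover have "\<exists>c'. (const c * F, const c * G) = (const c' * (const e * F), const c' * (const e * G)) \<and> c' \<noteq> 0"
    if "c \<noteq> 0" for c
    using that assms
    by (intro exI[of _ "c / e"]) (simp add: mult.assoc[symmetric] const_simps(4)[symmetric])
  ultimately show ?thesis unfolding rat_map_def by auto
qed

text \<open>
  Let \<open>f = p X\<^sub>0 + q X\<^sub>1\<close>, \<open>V\<^sub>1 = l X\<^sub>0 + m X\<^sub>1\<close> and \<open>D = p m - q l \<noteq> 0\<close>. The matrix \<open>\<gamma>\<close> with rows \<open>(u0, v0)\<close> and \<open>(u1, v1)\<close> is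
  the involution \<open>(\<partial>Q/\<partial>X\<^sub>1, -\<partial>Q/\<partial>X\<^sub>0)\<close> attached to \<open>Q = f V\<^sub>1\<close>; it fixes the zeros of \<open>f\<close> and of \<open>V\<^sub>1\<close>,
  and it sends \<open>f\<close> to \<open>D f\<close> and \<open>V\<^sub>1\<close> to \<open>-D V\<^sub>1\<close>. Write \<open>g\<close> in terms of \<open>V\<^sub>1\<close> and \<open>f\<close>. The monomials
  \<open>V\<^sub>1\<^sup>3\<close> and \<open>V\<^sub>1 f\<^sup>2\<close> are multiplied by \<open>-D\<^sup>3\<close>, the other two by \<open>D\<^sup>3\<close>. The coefficient of \<open>V\<^sub>1\<^sup>2 f\<close>
  vanishes because \<open>V\<^sub>1\<close> is the second polar of \<open>g\<close> at the zero of \<open>f\<close>, and that of \<open>f\<^sup>3\<close> is a multiple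
  of \<open>r\<close>. So \<open>g\<close> is multiplied by \<open>-D\<^sup>3\<close> when \<open>r = 0\<close>.
\<close>

lemma involution_of_pair:
  fixes p q a b c d :: "'a::field_char_0"
  defines "l \<equiv> a*q^2 - 2*b*p*q + c*p^2" and "m \<equiv> b*q^2 - 2*c*p*q + d*p^2"
  defines "D \<equiv> p * m - q * l"
  defines "u0 \<equiv> q * l + p * m" and "v0 \<equiv> 2 * q * m" and "u1 \<equiv> - 2 * p * l" and "v1 \<equiv> - (q * l + p * m)"
  defines "r \<equiv> inv_r (lin p q) (cubic a b c d)"
  shows "u0 * v1 - v0 * u1 = - (D^2)" "p * u0 + q * u1 = D * p" "p * v0 + q * v1 = D * q"
    "cubic_polar a b c d u0 u1 u0 u1 u0 u1 = - (D^3) * a + 2 * D * r * p^3"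
    "cubic_polar a b c d u0 u1 u0 u1 v0 v1 = - (D^3) * b + 2 * D * r * p^2 * q"
    "cubic_polar a b c d u0 u1 v0 v1 v0 v1 = - (D^3) * c + 2 * D * r * p * q^2"
    "cubic_polar a b c d v0 v1 v0 v1 v0 v1 = - (D^3) * d + 2 * D * r * q^3"
proof -
  \<comment> \<open>The values of the polar form that give, up to powers of \<open>D\<close>, the coefficients of \<open>V\<^sub>1\<^sup>2 f\<close>
    and of \<open>f\<^sup>3\<close>: \<open>(q, -p)\<close> is the zero of \<open>f\<close> and \<open>(m, -l)\<close> the zero of \<open>V\<^sub>1\<close>.\<close>
  define S T where "S = cubic_polar a b c d q (- p) q (- p) m (- l)"
    and "T = cubic_polar a b c d m (- l) m (- l) m (- l)"
  have S: "S = 0"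
    by (simp add: S_def cubic_polar_def l_def m_def algebra_simps power2_eq_square)
  have T: "T = D * r"
    unfolding T_def r_def inv_r_eq D_def cubic_polar_def l_def m_def
    by (simp add: algebra_simps power2_eq_square power3_eq_cube)
  note defs = u0_def u1_def v0_def v1_def D_def
  show "u0 * v1 - v0 * u1 = - (D^2)" "p * u0 + q * u1 = D * p" "p * v0 + q * v1 = D * q"
    unfolding defs by (simp_all add: algebra_simps power2_eq_square)
  have "cubic_polar a b c d u0 u1 u0 u1 u0 u1 = - (D^3) * a + 6 * l^2 * p * S + 2 * p^3 * T"
    "cubic_polar a b c d u0 u1 u0 u1 v0 v1 = - (D^3) * b + 2 * (l^2 * q + 2 * l * m * p) * S + 2 * p^2 * q * T"
    "cubic_polar a b c d u0 u1 v0 v1 v0 v1 = - (D^3) * c + 2 * (m^2 * p + 2 * l * m * q) * S + 2 * p * q^2 * T"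
    "cubic_polar a b c d v0 v1 v0 v1 v0 v1 = - (D^3) * d + 6 * m^2 * q * S + 2 * q^3 * T"
    unfolding defs S_def T_def cubic_polar_def by (simp_all add: algebra_simps power2_eq_square power3_eq_cube)
  then show "cubic_polar a b c d u0 u1 u0 u1 u0 u1 = - (D^3) * a + 2 * D * r * p^3"
    "cubic_polar a b c d u0 u1 u0 u1 v0 v1 = - (D^3) * b + 2 * D * r * p^2 * q"
    "cubic_polar a b c d u0 u1 v0 v1 v0 v1 = - (D^3) * c + 2 * D * r * p * q^2"
    "cubic_polar a b c d v0 v1 v0 v1 v0 v1 = - (D^3) * d + 2 * D * r * q^3"
    by (simp_all add: S T mult_ac)
qed

text \<open>
  The involution is built from \<open>p X\<^sub>0 + q X\<^sub>1\<close>, whereas the linear form of the map is \<open>k\<close> times this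
  form. The factor \<open>k = 0\<close> serves for maps whose linear form vanishes.
\<close>

lemma nontrivial_Aut:
  fixes p q a b c d k :: "'a::field_char_0"
  assumes r: "inv_r (lin p q) (cubic a b c d) = 0" and s1: "inv_s\<^sub>1 (lin p q) (cubic a b c d) \<noteq> 0"
  shows "\<not> trivial_Aut (map_of_pair (k * p) (k * q) a b c d)"
proof
  define \<phi> where "\<phi> = map_of_pair (k * p) (k * q) a b c d"
  define l m where "l = a*q^2 - 2*b*p*q + c*p^2" and "m = b*q^2 - 2*c*p*q + d*p^2"
  define D where "D = p * m - q * l"
  define u0 u1 v0 v1 where uv: "u0 = q * l + p * m" "u1 = - 2 * p * l" "v0 = 2 * q * m"
     "v1 = - (q * l + p * m)"
  define \<gamma> where "\<gamma> = (lin u0 v0, lin u1 v1)"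
  assume "trivial_Aut (map_of_pair (k * p) (k * q) a b c d)"
  then have triv: "Aut \<phi> = {rat_map (X\<^sub>0, X\<^sub>1)}" by (simp add: trivial_Aut_def \<phi>_def)
  have "inv_s\<^sub>1 (lin p q) (cubic a b c d) = - D"
    by (simp add: inv_s1_eq D_def l_def m_def algebra_simps power2_eq_square power3_eq_cube)
  with s1 have D: "D \<noteq> 0" by simp
  note inv = involution_of_pair[where p = p and q = q and a = a and b = b and c = c and d = d,
      folded l_def m_def, folded D_def, folded uv, unfolded r, simplified]
  have "k * p * u0 + k * q * u1 = k * (p * u0 + q * u1)" "k * p * v0 + k * q * v1 = k * (p * v0 + q * v1)"
    by (simp_all add: algebra_simps)
  then have kp: "- (D^2) * (k * p * u0 + k * q * u1) = - (D^3) * (k * p)"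
    "- (D^2) * (k * p * v0 + k * q * v1) = - (D^3) * (k * q)"
    using inv by (simp_all add: power2_eq_square power3_eq_cube)
  have "comp_map (pgl_inverse \<gamma>) (comp_map \<phi> \<gamma>) =
     map_of_pair (- (D^3) * (k * p)) (- (D^3) * (k * q)) (- (D^3) * a) (- (D^3) * b) (- (D^3) * c) (- (D^3) * d)"
    unfolding \<gamma>_def \<phi>_def conj_map_of_pair inv(1) kp by (simp add: inv)
  also have "rat_map \<dots> = rat_map \<phi>"
    unfolding map_of_pair_scale using D by (subst rat_map_scale) (simp_all add: \<phi>_def)
  finally have "rat_map (comp_map (pgl_inverse \<gamma>) (comp_map \<phi> \<gamma>)) = rat_map \<phi>" .
  moreover have "\<gamma> \<in> GL2"
    using inv(1) D binary_form_1 by (auto simp: GL2_def \<gamma>_def lin_det_lin)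
  ultimately have "rat_map \<gamma> \<in> Aut \<phi>" unfolding Aut_def by blast
  then have "rat_map \<gamma> = rat_map (X\<^sub>0, X\<^sub>1)" using triv by simp
  moreover have "\<gamma> \<in> rat_map \<gamma>"
    unfolding rat_map_def \<gamma>_def by (auto simp: const_simps intro!: exI[of _ 1])
  ultimately obtain e where e: "e \<noteq> 0" "\<gamma> = (const e * X\<^sub>0, const e * X\<^sub>1)"
    unfolding rat_map_def by auto
  \<comment> \<open>The involution has trace zero, whereas \<open>e\<close> times the identity has trace \<open>2 e\<close>.\<close>
  then have "u0 = e" "v1 = e"
    by (auto simp: \<gamma>_def form_simps X\<^sub>0_def X\<^sub>1_def)
  then have "e + e = 0" by (simp add: uv)
  with e show False by (simp flip: mult_2)
qed

text \<open>
  If the zero of \<open>f\<close> is a zero of \<open>g\<close> and of the Hessian of \<open>g\<close>, then it is a double zero of \<open>g\<close>, and the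
  discriminant \<open>s\<^sub>3\<close> vanishes. The proof solves the two equations for the coefficients \<open>a\<close> and \<open>b\<close>,
  which is possible when \<open>q \<noteq> 0\<close>; exchanging \<open>X\<^sub>0\<close> and \<open>X\<^sub>1\<close> gives the remaining case.
\<close>

lemma s3_eq_0_aux:
  fixes p q a b c d :: "'a::field_char_0"
  assumes "inv_s\<^sub>1 (lin p q) (cubic a b c d) = 0" "inv_s\<^sub>2 (lin p q) (cubic a b c d) = 0" and q: "q \<noteq> 0"
  shows "inv_s\<^sub>3 (lin p q) (cubic a b c d) = 0"
proof -
  define z where "z = p / q"
  have p: "p = z * q" using q by (simp add: z_def)
  have "q^3 * (a - 3*b*z + 3*c*z^2 - d*z^3) = 0"
    using assms(1) unfolding inv_s1_eq p by (simp add: algebra_simps power2_eq_square power3_eq_cube)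
  then have "a - 3*b*z + 3*c*z^2 - d*z^3 = 0" using q by simp
  then have a: "a = 3*b*z - 3*c*z^2 + d*z^3" by (simp add: algebra_simps)
  have "(-2*q^2) * (b - 2*c*z + d*z^2)^2 = 0"
    using assms(2) unfolding inv_s2_eq p a by (simp add: algebra_simps power2_eq_square power3_eq_cube)
  then have "b - 2*c*z + d*z^2 = 0" using q by simp
  then have b: "b = 2*c*z - d*z^2" by (simp add: algebra_simps)
  show ?thesis
    unfolding inv_s3_eq a b by (simp add: algebra_simps power2_eq_square power3_eq_cube)
qed

lemma s3_eq_0:
  fixes p q a b c d :: "'a::field_char_0"
  assumes s1: "inv_s\<^sub>1 (lin p q) (cubic a b c d) = 0" and s2: "inv_s\<^sub>2 (lin p q) (cubic a b c d) = 0"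
     and pq: "p \<noteq> 0 \<or> q \<noteq> 0"
  shows "inv_s\<^sub>3 (lin p q) (cubic a b c d) = 0"
proof (cases "q = 0")
  case True
  then have "inv_s\<^sub>3 (lin q p) (cubic d c b a) = 0"
    using pq s1 s2 by (intro s3_eq_0_aux) (simp_all add: inv_s1_eq inv_s2_eq algebra_simps)
  then show ?thesis by (simp add: inv_s3_eq algebra_simps)
qed (use s3_eq_0_aux s1 s2 in blast)

text \<open>
  The invariant \<open>r\<close> is the value of the cubic form \<open>t\<close> at the zero of \<open>f\<close>, so it suffices to take a zero
  of \<open>t\<close>. If \<open>t\<close> has no zero at infinity, its dehomogenization has degree 3.
\<close>

lemma inv_r_has_zero:
  fixes a b c d :: "'a::{alg_closed_field, field_char_0}"
  obtains p q where "p \<noteq> 0 \<or> q \<noteq> 0" "inv_r (lin p q) (cubic a b c d) = 0"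
proof (cases "a^2*d - 3*a*b*c + 2*b^3 = 0")
  case True
  then have "inv_r (lin 0 1) (cubic a b c d) = 0" by (simp add: inv_r_eq)
  then show ?thesis using that[of 0 1] by simp
next
  case False
  define t where "t = [: - (3*b*c*d - 2*c^3 - a*d^2), 3 * (2*b^2*d - b*c^2 - a*c*d),
       - 3 * (a*b*d - 2*a*c^2 + b^2*c), a^2*d - 3*a*b*c + 2*b^3 :]"
  have "degree t > 0" using False by (simp add: t_def)
  then obtain z where "poly t z = 0" using alg_closed_imp_poly_has_root by blast
  then have "inv_r (lin 1 z) (cubic a b c d) = 0"
    unfolding t_def inv_r_eq by (simp add: algebra_simps power2_eq_square power3_eq_cube)
  then show ?thesis using that[of 1 z] by simp
qed

text \<open>
  Let \<open>r = 0\<close>. The involution above needs a nonzero linear form \<open>f'\<close>, of which \<open>f\<close> is a multiple, with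
  \<open>r (f', g) = 0\<close> and \<open>s\<^sub>1 (f', g) \<noteq> 0\<close>: take \<open>f\<close> itself if \<open>f \<noteq> 0\<close>, and otherwise any form at whose zero
  \<open>t\<close> vanishes. If \<open>s\<^sub>1 (f', g)\<close> were zero, the relation between the invariants would give \<open>s\<^sub>2 = 0\<close>
  and then \<open>s\<^sub>3 = 0\<close>, contradicting that the resultant is nonzero.
\<close>

lemma trivial_Aut_imp_inv_r_nonzero:
  fixes p q a b c d :: "'a::{alg_closed_field, field_char_0}"
  assumes triv: "trivial_Aut (map_of_pair p q a b c d)"
    and res: "inv_resultant (lin p q) (cubic a b c d) \<noteq> 0"
  shows "inv_r (lin p q) (cubic a b c d) \<noteq> 0"
proof
  assume r: "inv_r (lin p q) (cubic a b c d) = 0"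
  obtain p' q' k where k: "p = k * p'" "q = k * q'" and nz: "p' \<noteq> 0 \<or> q' \<noteq> 0"
    and r': "inv_r (lin p' q') (cubic a b c d) = 0"
    and s3: "inv_s\<^sub>3 (lin p' q') (cubic a b c d) = 0 \<Longrightarrow> inv_s\<^sub>1 (lin p' q') (cubic a b c d) = 0
       \<Longrightarrow> inv_s\<^sub>2 (lin p' q') (cubic a b c d) = 0 \<Longrightarrow> False"
  proof (cases "p = 0 \<and> q = 0")
    case True
    obtain p' q' where "p' \<noteq> 0 \<or> q' \<noteq> 0" "inv_r (lin p' q') (cubic a b c d) = 0"
      by (rule inv_r_has_zero)
    moreover have "inv_s\<^sub>3 (lin p' q') (cubic a b c d) \<noteq> 0"
      using res True by (simp add: inv_resultant_def inv_s1_eq inv_s2_eq inv_s3_eq)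
    ultimately show ?thesis using that[of 0 p' q'] True by simp
  next
    case False
    show ?thesis by (rule that[of 1 p q]) (use False r res in \<open>auto simp: inv_resultant_def\<close>)
  qed
  have "inv_s\<^sub>1 (lin p' q') (cubic a b c d) \<noteq> 0"
  proof
    assume s1: "inv_s\<^sub>1 (lin p' q') (cubic a b c d) = 0"
    then have s2: "inv_s\<^sub>2 (lin p' q') (cubic a b c d) = 0"
      using inv_relation[of p' q' a b c d] r' by simp
    show False using s3 s3_eq_0[OF s1 s2 nz] s1 s2 by blast
  qed
  from nontrivial_Aut[OF r' this, of k] triv show False unfolding k by simp
qed

section \<open>Moduli points and base extension\<close>

lemma wpoint_scale:
  assumes "e \<noteq> 0"
  shows "wpoint (e^4 * s1) (e^4 * s2) (e^4 * s3) (e^6 * r) = wpoint s1 s2 s3 r"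
proof -
  have "\<exists>c'. (c^4 * (e^4 * s1), c^4 * (e^4 * s2), c^4 * (e^4 * s3), c^6 * (e^6 * r)) =
      (c'^4 * s1, c'^4 * s2, c'^4 * s3, c'^6 * r) \<and> c' \<noteq> 0" if "c \<noteq> 0" for c
    using that assms by (intro exI[of _ "c * e"]) (simp add: power_mult_distrib)
  moreover have "\<exists>c'. (c^4 * s1, c^4 * s2, c^4 * s3, c^6 * r) =
     (c'^4 * (e^4 * s1), c'^4 * (e^4 * s2), c'^4 * (e^4 * s3), c'^6 * (e^6 * r)) \<and> c' \<noteq> 0" if "c \<noteq> 0" for c
    using that assms by (intro exI[of _ "c / e"]) (simp add: power_divide)
  ultimately show ?thesis unfolding wpoint_def by auto
qed

lemma wpoint_self: "(s1, s2, s3, r) \<in> wpoint s1 s2 s3 r"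
  unfolding wpoint_def by (auto intro!: exI[of _ 1])

lemma bembed_lin: "bembed (lin p q) = lin (to_ac p) (to_ac q)"
  by (simp add: bembed_def form_pCons map_poly_pCons)

lemma bembed_cubic: "bembed (cubic a b c d) = cubic (to_ac a) (to_ac b) (to_ac c) (to_ac d)"
  by (simp add: bembed_def form_pCons map_poly_pCons)

lemma inv_bembed:
  fixes f g :: "'k::field_char_0 bpoly"
  assumes "binary_form 1 f" "binary_form 3 g"
  shows "inv_s\<^sub>1 (bembed f) (bembed g) = to_ac (inv_s\<^sub>1 f g)"
    "inv_s\<^sub>2 (bembed f) (bembed g) = to_ac (inv_s\<^sub>2 f g)"
    "inv_s\<^sub>3 (bembed f) (bembed g) = to_ac (inv_s\<^sub>3 f g)"
    "inv_r (bembed f) (bembed g) = to_ac (inv_r f g)"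
  using assms unfolding binary_form_1 binary_form_3
  by (auto simp: bembed_lin bembed_cubic inv_s1_eq inv_s2_eq inv_s3_eq inv_r_eq)

text \<open>
  The resultant is expressed through the invariants, so its nonvanishing descends from the pair over
  the algebraic closure to the coordinates in the base field.
\<close>

lemma corresponding_valueE:
  fixes s1 s2 s3 r v :: "'k::field_char_0"
  assumes "corresponding_value I s1 s2 s3 r v"
  obtains p q a b c d where
    "inv_s\<^sub>1 (lin p q) (cubic a b c d) = to_ac s1" "inv_s\<^sub>2 (lin p q) (cubic a b c d) = to_ac s2"
    "inv_s\<^sub>3 (lin p q) (cubic a b c d) = to_ac s3" "inv_r (lin p q) (cubic a b c d) = to_ac r"
    "I (lin p q) (cubic a b c d) = to_ac v"
    "27 * s3 - 9 * s2 - 2 * s1 \<noteq> 0"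
proof -
  obtain \<phi> f g where \<phi>: "quadratic_map \<phi>" "pair_of_map \<phi> = (f, g)"
    and vals: "inv_s\<^sub>1 f g = to_ac s1" "inv_s\<^sub>2 f g = to_ac s2"
        "inv_s\<^sub>3 f g = to_ac s3" "inv_r f g = to_ac r" "I f g = to_ac v"
    using assms unfolding corresponding_value_def by blast
  obtain p q a b c d where pq: "\<phi> = map_of_pair p q a b c d"
    and res: "inv_resultant (lin p q) (cubic a b c d) \<noteq> 0"
    using \<phi>(1) by (rule quadratic_mapE)
  have fg: "f = lin p q" "g = cubic a b c d" using \<phi>(2) unfolding pq pair_of_map_of_pair by simp_all
  have "to_ac (27 * s3 - 9 * s2 - 2 * s1) \<noteq> to_ac 0"
    using res vals unfolding fg inv_resultant_def by simp
  then have "27 * s3 - 9 * s2 - 2 * s1 \<noteq> 0" by (subst (asm) to_ac_eq_iff)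
  with vals show ?thesis unfolding fg by (intro that)
qed

section \<open>Reconstruction\<close>

text \<open>
  The reconstructed pair for \<open>W\<^sub>0 = X\<^sub>0\<close>, \<open>W\<^sub>1 = X\<^sub>1\<close>. Its invariants are those of a point with coordinates
  \<open>s\<^sub>1, s\<^sub>2, s\<^sub>3, r\<close>, scaled by a number \<open>e\<close> with \<open>e\<^sup>2 = -r\<close>: the factors are \<open>e\<^sup>4\<close> and \<open>e\<^sup>6\<close>.
\<close>

lemma inv_reconstruction:
  fixes s1 s2 s3 r :: "'a::field_char_0"
  assumes rel: "2 * r^2 = s1^2 * s3 - s2^3"
  defines "f \<equiv> lin s1 (- s2)" and "g \<equiv> cubic (- s1) (s2 / 2) 0 (- s3 / 2)"
  shows "inv_s\<^sub>1 f g = r^2 * s1" "inv_s\<^sub>2 f g = r^2 * s2" "inv_s\<^sub>3 f g = r^2 * s3"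
    "inv_r f g = - (r^3) * r"
proof -
  define y z where "y = s2 / 2" and "z = s3 / 2"
  have yz: "s2 = 2 * y" "s3 = 2 * z" by (simp_all add: y_def z_def)
  have "2 * r^2 = 2 * (s1^2 * z - 4 * y^3)"
    using rel unfolding yz by (simp add: power_mult_distrib algebra_simps)
  then have r2: "r^2 = s1^2 * z - 4 * y^3" by (metis mult_left_cancel zero_neq_numeral)
  show "inv_s\<^sub>1 f g = r^2 * s1" "inv_s\<^sub>2 f g = r^2 * s2" "inv_s\<^sub>3 f g = r^2 * s3"
    unfolding f_def g_def inv_s1_eq inv_s2_eq inv_s3_eq r2 unfolding yz
    by (simp_all add: algebra_simps power2_eq_square power3_eq_cube)
  have "inv_r f g = - ((r^2)^2)"
    unfolding f_def g_def inv_r_eq r2 unfolding yz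
    by (simp_all add: algebra_simps power2_eq_square power3_eq_cube)
  then show "inv_r f g = - (r^3) * r" by (simp add: power2_eq_square power3_eq_cube)
qed

text \<open>
  Every nonzero \<open>a\<^sub>i\<^sub>j\<^sub>k\<close> contains the factor \<open>r\<close>, which the prefactor cancels; what remains is a cubic
  form in \<open>W\<^sub>0, W\<^sub>1\<close> without \<open>W\<^sub>0 W\<^sub>1\<^sup>2\<close> term.
\<close>

lemma reconstruction_forms:
  fixes s1 s2 s3 r :: "'a::field_char_0" and W :: "bit \<Rightarrow> 'a bpoly"
  assumes r: "r \<noteq> 0"
    and a: "a 0 0 0 = 1/9 * s3 * r" "a 1 0 0 = 0" "a 0 1 0 = 0" "a 0 0 1 = 0"
      "a 1 1 0 = - 1/9 * s2 * r" "a 1 0 1 = - 1/9 * s2 * r" "a 0 1 1 = - 1/9 * s2 * r"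
      "a 1 1 1 = - 2/9 * s1 * r"
  shows "const (- 9 / (2 * r)) *
        (\<Sum>i\<in>UNIV. \<Sum>j\<in>UNIV. \<Sum>k\<in>UNIV.
           bit_sign (i + j + k) * const (a i j k) * W (i + 1) * W (j + 1) * W (k + 1)) =
    bsubst (cubic (- s1) (s2 / 2) 0 (- s3 / 2)) (W 0) (W 1)"
proof -
  have UNIV_bit: "(UNIV :: bit set) = {0, 1}"
    by (auto intro: bit.exhaust)
  have c: "const (- 9 / (2 * r)) * const (1/9 * s3 * r) = const (- s3 / 2)"
    "const (- 9 / (2 * r)) * const (- 1/9 * s2 * r) = const (s2 / 2)"
    "const (- 9 / (2 * r)) * const (- 2/9 * s1 * r) = - const (- s1)"
    using r by (simp_all add: const_def)
  have c3: "const (3 * x) = 3 * const x" for x :: 'a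
    by (simp add: const_def numeral_poly)
  have S: "(\<Sum>i\<in>UNIV. \<Sum>j\<in>UNIV. \<Sum>k\<in>UNIV.
           bit_sign (i + j + k) * const (a i j k) * W (i + 1) * W (j + 1) * W (k + 1)) =
     const (1/9 * s3 * r) * W 1 ^ 3 + 3 * (const (- 1/9 * s2 * r) * (W 0 ^ 2 * W 1))
      - const (- 2/9 * s1 * r) * W 0 ^ 3"
    unfolding UNIV_bit
    by (simp add: bit_sign_def a const_simps(1) power2_eq_square power3_eq_cube algebra_simps)
  have dist: "e * (x * M + 3 * (y * N) - z * L) = (e * x) * M + 3 * ((e * y) * N) - (e * z) * L"
    for e x y z L M N :: "'a bpoly"
    by (simp add: algebra_simps)
  show ?thesis
    unfolding S dist c bsubst_cubic c3 by (simp add: const_simps(1,3) algebra_simps)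
qed

theorem theorem5p1:
  fixes P :: "('k::field_char_0 alg_closure \<times> 'k alg_closure \<times> 'k alg_closure \<times> 'k alg_closure) set"
    and \<phi> :: "'k alg_closure bpoly \<times> 'k alg_closure bpoly"
    and s\<^sub>1 s\<^sub>2 s\<^sub>3 r :: 'k
    and b :: "bit \<Rightarrow> 'k" and a :: "bit \<Rightarrow> bit \<Rightarrow> bit \<Rightarrow> 'k"
    and W :: "bit \<Rightarrow> 'k bpoly"
    and f g :: "'k bpoly"
  assumes P_rational: "P \<in> M2_rational"
    and map: "quadratic_map \<phi>" "P = pair_point (pair_of_map \<phi>)" "trivial_Aut \<phi>"
    and coords: "P = wpoint (to_ac s\<^sub>1) (to_ac s\<^sub>2) (to_ac s\<^sub>3) (to_ac r)"
    and b: "\<And>i. corresponding_value (inv_b i) s\<^sub>1 s\<^sub>2 s\<^sub>3 r (b i)"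
    and a: "\<And>i j k. corresponding_value (inv_a i j k) s\<^sub>1 s\<^sub>2 s\<^sub>3 r (a i j k)"
    and W: "(W 0, W 1) \<in> SL2"
    and f: "f = const (b 0) * W 0 - const (b 1) * W 1"
    and g: "g = const (- 9 / (2 * r)) *
        (\<Sum>i\<in>UNIV. \<Sum>j\<in>UNIV. \<Sum>k\<in>UNIV.
           bit_sign (i + j + k) * const (a i j k) * W (i + 1) * W (j + 1) * W (k + 1))"
  shows "binary_form 1 f \<and> binary_form 3 g \<and>
    (\<exists>\<psi> :: 'k bpoly \<times> 'k bpoly. quadratic_map \<psi> \<and> pair_of_map \<psi> = (f, g)) \<and>
    pair_point (bembed f, bembed g) = P"
proof -
  obtain p q a' b' c' d' where \<phi>: "\<phi> = map_of_pair p q a' b' c' d'"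
    and res: "inv_resultant (lin p q) (cubic a' b' c' d') \<noteq> 0"
    using map(1) by (rule quadratic_mapE)
  have "inv_r (lin p q) (cubic a' b' c' d') \<noteq> 0"
    using trivial_Aut_imp_inv_r_nonzero[OF _ res] map(3) unfolding \<phi> by blast
  moreover have "(to_ac s\<^sub>1, to_ac s\<^sub>2, to_ac s\<^sub>3, to_ac r) \<in> pair_point (pair_of_map \<phi>)"
    using map(2) coords wpoint_self by metis
  ultimately have r: "r \<noteq> 0"
    unfolding \<phi> pair_of_map_of_pair pair_point_def wpoint_def by auto

  have rel: "2 * r^2 = s\<^sub>1^2 * s\<^sub>3 - s\<^sub>2^3" and res: "27 * s\<^sub>3 - 9 * s\<^sub>2 - 2 * s\<^sub>1 \<noteq> 0" and b0: "b 0 = s\<^sub>1"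
  proof -
    from b[of 0] obtain p q a b' c d where
      vals: "inv_s\<^sub>1 (lin p q) (cubic a b' c d) = to_ac s\<^sub>1" "inv_s\<^sub>2 (lin p q) (cubic a b' c d) = to_ac s\<^sub>2"
        "inv_s\<^sub>3 (lin p q) (cubic a b' c d) = to_ac s\<^sub>3" "inv_r (lin p q) (cubic a b' c d) = to_ac r"
        "inv_b 0 (lin p q) (cubic a b' c d) = to_ac (b 0)" "27 * s\<^sub>3 - 9 * s\<^sub>2 - 2 * s\<^sub>1 \<noteq> 0"
      by (rule corresponding_valueE)
    have "to_ac (2 * r^2) = to_ac (s\<^sub>1^2 * s\<^sub>3 - s\<^sub>2^3)"
      using inv_relation[of p q a b' c d] unfolding vals by simp
    then show "2 * r^2 = s\<^sub>1^2 * s\<^sub>3 - s\<^sub>2^3" unfolding to_ac_eq_iff .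
    show "27 * s\<^sub>3 - 9 * s\<^sub>2 - 2 * s\<^sub>1 \<noteq> 0" by (rule vals)
    show "b 0 = s\<^sub>1" using vals inv_b0_eq[of p q a b' c d] by simp
  qed
  have b1: "b 1 = s\<^sub>2"
    using b[of 1] by (rule corresponding_valueE) (simp add: inv_b1_eq)
  have a': "a i j k = (let n = of_bit i + of_bit j + of_bit k :: nat in
      if n = 0 then 1/9 * s\<^sub>3 * r else if n = 1 then 0
      else if n = 2 then - 1/9 * s\<^sub>2 * r else - 2/9 * s\<^sub>1 * r)" (is "_ = ?v") for i j k
  proof -
    obtain p q a1 b1 c1 d1 where
      vals: "inv_s\<^sub>1 (lin p q) (cubic a1 b1 c1 d1) = to_ac s\<^sub>1" "inv_s\<^sub>2 (lin p q) (cubic a1 b1 c1 d1) = to_ac s\<^sub>2"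
        "inv_s\<^sub>3 (lin p q) (cubic a1 b1 c1 d1) = to_ac s\<^sub>3" "inv_r (lin p q) (cubic a1 b1 c1 d1) = to_ac r"
        "inv_a i j k (lin p q) (cubic a1 b1 c1 d1) = to_ac (a i j k)"
      using a[of i j k] by (rule corresponding_valueE)
    have "to_ac (a i j k) = to_ac ?v"
      unfolding vals(5)[symmetric] inv_a_def vals(1-4) Let_def by simp
    then show ?thesis unfolding to_ac_eq_iff .
  qed

  define F where "F = lin s\<^sub>1 (- s\<^sub>2)"
  define G where "G = cubic (- s\<^sub>1) (s\<^sub>2 / 2) 0 (- s\<^sub>3 / 2)"
  have f': "f = bsubst F (W 0) (W 1)"
    by (simp add: f F_def b0 b1 bsubst_lin const_simps)
  have g': "g = bsubst G (W 0) (W 1)"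
    unfolding g G_def by (rule reconstruction_forms[OF r]) (simp_all add: a')
  have FG: "binary_form 1 F" "binary_form 3 G"
    unfolding F_def G_def binary_form_1 binary_form_3 by blast+
  note inv = inv_SL2_invariant[OF FG W, folded f' g', unfolded F_def G_def inv_reconstruction[OF rel]]

  obtain u0 v0 u1 v1 where "W 0 = lin u0 v0" "W 1 = lin u1 v1"
    using W unfolding SL2_def binary_form_1 by blast
  then obtain p q A B C D where fg: "f = lin p q" "g = cubic A B C D"
    unfolding f' g' F_def G_def by (simp only: bsubst_lin_lin bsubst_cubic_lin)
  then have forms: "binary_form 1 f" "binary_form 3 g"
    unfolding binary_form_1 binary_form_3 by blast+
  have "inv_resultant f g = r^2 * (27 * s\<^sub>3 - 9 * s\<^sub>2 - 2 * s\<^sub>1)"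
    unfolding inv_resultant_def inv by (simp add: algebra_simps)
  then have "quadratic_map (map_of_pair p q A B C D)"
    using r res by (intro quadratic_map_of_pairI) (simp add: fg)
  then have ex: "\<exists>\<psi> :: 'k bpoly \<times> 'k bpoly. quadratic_map \<psi> \<and> pair_of_map \<psi> = (f, g)"
    using pair_of_map_of_pair fg by blast

  \<comment> \<open>The scaling factor \<open>e\<close> may lie outside the base field; only \<open>e\<^sup>4\<close> and \<open>e\<^sup>6\<close> enter.\<close>
  obtain e :: "'k alg_closure" where e: "e^2 = - to_ac r"
    using nth_root_exists[of 2] by auto
  have "e^4 = (e^2)^2" "e^6 = (e^2)^3" by (simp_all flip: power_mult)
  then have e46: "e^4 = to_ac (r^2)" "e^6 = to_ac (- (r^3))" by (simp_all add: e)
  have "e \<noteq> 0" using e r by auto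
  have "pair_point (bembed f, bembed g) =
     wpoint (e^4 * to_ac s\<^sub>1) (e^4 * to_ac s\<^sub>2) (e^4 * to_ac s\<^sub>3) (e^6 * to_ac r)"
    unfolding pair_point_def prod.case inv_bembed[OF forms] inv e46 to_ac_mult ..
  also have "\<dots> = P" unfolding coords by (rule wpoint_scale[OF \<open>e \<noteq> 0\<close>])
  finally show ?thesis using forms ex by blast
qed

end
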